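(* Let $\hat\tau\in\mathbb N$, let $g:=\lceil 5\cdot n_{\mathcal L}\cdot\hat\tau\cdot\log\hat\tau\rceil$, and let $\varepsilon>0$. There is $\delta>0$ such that whenever $\mathcal M$ is a Borel $\mathcal L$-structure that does not have the $(\delta,\hat\tau)$-branching property, there exist a Borel $\mathcal L$-structure $\mathcal M^+$ and an equitable Borel partition $P$ of $[0,1]$ such that (i) $d_1(\mathcal M,\mathcal M^+)\le\varepsilon$; (ii) $P$ is indivisible with respect to $\mathcal M^+$; (iii) $|P|\le\bigl(\frac{\varepsilon}{6q_{\mathcal L}|\mathcal L|}\bigr)^{-(g+1)(g+2)}$.
   Context: $\mathcal{L}$ is a fixed finite relational language; $q_{\mathcal L}:=\max\{\mathrm{arity}(E):E\in\mathcal L\}$, $n_{\mathcal L}:=|\mathcal L|\cdot q_{\mathcal L}$; logarithms base 2; $\lambda$ is Lebesgue measure. A Borel $\mathcal L$-structure is an $\mathcal L$-structure with underlying set $[0,1]$ in which every relation $E^{\mathcal M}\subseteq[0,1]^{\mathrm{arity}(E)}$ is Borel; $\widetilde E^{\mathcal M}$ denotes its characteristic function. $d_1(\mathcal M,\mathcal N):=\sum_{E\in\mathcal L}\int_{[0,1]^{\mathrm{arity}(E)}}|\widetilde E^{\mathcal M}(\mathbf x)-\widetilde E^{\mathcal N}(\mathbf x)|\,d\mathbf x$. For a finite $\mathcal L$-structure $\mathcal F$ with underlying set $\{0,\dots,k-1\}$ and a Borel $\mathcal L$-structure $\mathcal N$, $t_{\mathrm{ind}}(\mathcal F,\mathcal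 N):=\lambda^k(I(\mathcal F,\mathcal N))$, where $I(\mathcal F,\mathcal N)\subseteq[0,1]^k$ is the set of tuples $(x_0,\dots,x_{k-1})$ such that $i\mapsto x_i$ is an embedding of $\mathcal F$ into $\mathcal N$ (injective, preserving all relations and their negations). Branching property: a quantifier-free formula $\varphi(\bar x;\bar y)$ has the $\hat\tau$-branching property in a structure $\mathcal F$ if there are tuples $\langle\bar a_i\rangle_{i\in\{0,1\}^{\hat\tau}}$ (length $|\bar x|$) and $\langle\bar b_j\rangle_{j\in\{0,1\}^{<\hat\tau}}$ (length $|\bar y|$) from $\mathcal F$ such that whenever $j^\frown h$ ($h\in\{0,1\}$) is an initial segment of $i$, $\mathcal F\models\varphi(\bar a_i;\bar b_j)$ iff $h=1$. $\mathcal F$ minimally has this property if no proper induced substructure of $\mathcal F$ has it. A Borel $\mathcal N$ has the $(\delta,\hat\tau)$-branching property if for some $E\in\mathcal L$ and some $j<\mathrm{arity}(E)$, with $\varphi=E(x_0,\dots)$ and partition $(x_j;\text{other variables})$, there is a finite structure $\mathcal F$ (underlying set an initial segment of $\mathbb N$) which minimally has the $\hat\tau$-branching property for $\varphi$ and with $t_{\mathrm{ind}}(\mathcal F,\mathcal N)\ge\delta$. A Borel partition of $[0,1]$ is a countable partition into Borel parts; it is equitable if all parts have the same Lebesgue measure; it is indivisible with respect to a Borel $\mathcal M^+$ if for all $E\in\mathcal L$ of arity $k$, all parts $p_0,\dots,p_{k-1}$ and all $a^0_i,a^1_i\in p_i$, $\widetilde E^{\mathcal M^+}(a^0_0,\dots,a^0_{k-1})=\widetilde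 E^{\mathcal M^+}(a^1_0,\dots,a^1_{k-1})$.
   Formalization: The formal statement assumes in addition that ε ≤ 6·q_L·|L|; for larger ε the bound (iii) is below 1, so no partition of [0,1] satisfies it, and the claim fails for the structure with all relations empty. It also takes q_L > 0, as the bound requires. *)

theory Defs
  imports "HOL-Analysis.Analysis" "HOL-Library.Sublist" "HOL-Library.Disjoint_Sets"
begin

text \<open>
  A finite relational language is a finite type of relation symbols with an arity function \<open>ar\<close>.
  A structure is given by its underlying set \<open>A\<close> and, for each symbol \<open>E\<close>, a set \<open>R E\<close> of
  \<open>ar E\<close>-tuples from \<open>A\<close>; a \<open>k\<close>-tuple is an extensional function on \<open>{..<k}\<close>.
\<close>

definition max_arity :: "('l::finite \<Rightarrow> nat) \<Rightarrow> nat" where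
  "max_arity ar = Max (range ar)"

definition lang_n :: "('l::finite \<Rightarrow> nat) \<Rightarrow> nat" where
  "lang_n ar = CARD('l) * max_arity ar"

definition is_structure ::
    "('l \<Rightarrow> nat) \<Rightarrow> 'a set \<Rightarrow> ('l \<Rightarrow> (nat \<Rightarrow> 'a) set) \<Rightarrow> bool" where
  "is_structure ar A R \<longleftrightarrow> (\<forall>E. R E \<subseteq> {..<ar E} \<rightarrow>\<^sub>E A)"

definition induced ::
    "('l \<Rightarrow> nat) \<Rightarrow> ('l \<Rightarrow> (nat \<Rightarrow> 'a) set) \<Rightarrow> 'a set \<Rightarrow> 'l \<Rightarrow> (nat \<Rightarrow> 'a) set" where
  "induced ar R B = (\<lambda>E. R E \<inter> ({..<ar E} \<rightarrow>\<^sub>E B))"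

definition embedding ::
    "('l \<Rightarrow> nat) \<Rightarrow> 'a set \<Rightarrow> ('l \<Rightarrow> (nat \<Rightarrow> 'a) set) \<Rightarrow> 'b set \<Rightarrow> ('l \<Rightarrow> (nat \<Rightarrow> 'b) set)
      \<Rightarrow> ('a \<Rightarrow> 'b) \<Rightarrow> bool" where
  "embedding ar A R B S f \<longleftrightarrow> f \<in> A \<rightarrow> B \<and> inj_on f A \<and>
     (\<forall>E. \<forall>v \<in> {..<ar E} \<rightarrow>\<^sub>E A. v \<in> R E \<longleftrightarrow> compose {..<ar E} f v \<in> S E)"

definition cube :: "nat \<Rightarrow> (nat \<Rightarrow> real) measure" where
  "cube k = PiM {..<k} (\<lambda>_. restrict_space lborel {0..1})"

text \<open>
  The product \<open>\<sigma>\<close>-algebra on \<open>[0,1]^k\<close> is its Borel \<open>\<sigma>\<close>-algebra, so membership in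
  \<open>sets (cube k)\<close> means being a Borel subset of \<open>[0,1]^k\<close>.
\<close>

definition borel_structure :: "('l \<Rightarrow> nat) \<Rightarrow> ('l \<Rightarrow> (nat \<Rightarrow> real) set) \<Rightarrow> bool" where
  "borel_structure ar M \<longleftrightarrow> is_structure ar {0..1} M \<and> (\<forall>E. M E \<in> sets (cube (ar E)))"

definition d1 ::
    "('l::finite \<Rightarrow> nat) \<Rightarrow> ('l \<Rightarrow> (nat \<Rightarrow> real) set) \<Rightarrow> ('l \<Rightarrow> (nat \<Rightarrow> real) set) \<Rightarrow> real" where
  "d1 ar M N = (\<Sum>E\<in>UNIV.
     integral\<^sup>L (cube (ar E)) (\<lambda>x. \<bar>indicat_real (M E) x - indicat_real (N E) x\<bar>))"

definition t_ind ::
    "('l \<Rightarrow> nat) \<Rightarrow> nat \<Rightarrow> ('l \<Rightarrow> (nat \<Rightarrow> nat) set) \<Rightarrow> ('l \<Rightarrow> (nat \<Rightarrow> real) set) \<Rightarrow> real" where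
  "t_ind ar k F N =
     measure (cube k) {x \<in> space (cube k). embedding ar {..<k} F {0..1} N x}"

text \<open>
  A formula is represented by its interpretation \<open>\<phi>\<close>, which maps the relations of a structure
  and an assignment of the free variables to a truth value. The variables are split into the
  disjoint sets \<open>X\<close> and \<open>Y\<close>. Binary strings are lists of Booleans.
\<close>

definition has_branching ::
    "(('l \<Rightarrow> (nat \<Rightarrow> 'a) set) \<Rightarrow> (nat \<Rightarrow> 'a) \<Rightarrow> bool) \<Rightarrow> nat set \<Rightarrow> nat set \<Rightarrow> nat
      \<Rightarrow> 'a set \<Rightarrow> ('l \<Rightarrow> (nat \<Rightarrow> 'a) set) \<Rightarrow> bool" where
  "has_branching \<phi> X Y \<tau> A R \<longleftrightarrow>
     (\<exists>(a :: bool list \<Rightarrow> nat \<Rightarrow> 'a) (b :: bool list \<Rightarrow> nat \<Rightarrow> 'a).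
        (\<forall>i. length i = \<tau> \<longrightarrow> a i \<in> X \<rightarrow>\<^sub>E A) \<and>
        (\<forall>j. length j < \<tau> \<longrightarrow> b j \<in> Y \<rightarrow>\<^sub>E A) \<and>
        (\<forall>i j h. length i = \<tau> \<longrightarrow> length j < \<tau> \<longrightarrow> prefix (j @ [h]) i \<longrightarrow>
           (\<phi> R (merge X Y (a i, b j)) \<longleftrightarrow> h)))"

definition minimally_has_branching ::
    "('l \<Rightarrow> nat) \<Rightarrow> (('l \<Rightarrow> (nat \<Rightarrow> 'a) set) \<Rightarrow> (nat \<Rightarrow> 'a) \<Rightarrow> bool) \<Rightarrow> nat set \<Rightarrow> nat set
      \<Rightarrow> nat \<Rightarrow> 'a set \<Rightarrow> ('l \<Rightarrow> (nat \<Rightarrow> 'a) set) \<Rightarrow> bool" where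
  "minimally_has_branching ar \<phi> X Y \<tau> A R \<longleftrightarrow>
     has_branching \<phi> X Y \<tau> A R \<and>
     (\<forall>B. B \<subset> A \<longrightarrow> \<not> has_branching \<phi> X Y \<tau> B (induced ar R B))"

definition borel_branching ::
    "('l \<Rightarrow> nat) \<Rightarrow> real \<Rightarrow> nat \<Rightarrow> ('l \<Rightarrow> (nat \<Rightarrow> real) set) \<Rightarrow> bool" where
  "borel_branching ar \<delta> \<tau> N \<longleftrightarrow>
     (\<exists>E j k (F :: 'l \<Rightarrow> (nat \<Rightarrow> nat) set).
        j < ar E \<and> is_structure ar {..<k} F \<and>
        minimally_has_branching ar (\<lambda>R v. v \<in> R E) {j} ({..<ar E} - {j}) \<tau> {..<k} F \<and>
        t_ind ar k F N \<ge> \<delta>)"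

definition borel_partition :: "real set set \<Rightarrow> bool" where
  "borel_partition P \<longleftrightarrow> countable P \<and> partition_on {0..1} P \<and> P \<subseteq> sets borel"

definition equitable :: "real set set \<Rightarrow> bool" where
  "equitable P \<longleftrightarrow> (\<forall>p\<in>P. \<forall>p'\<in>P. emeasure lborel p = emeasure lborel p')"

definition indivisible ::
    "('l \<Rightarrow> nat) \<Rightarrow> real set set \<Rightarrow> ('l \<Rightarrow> (nat \<Rightarrow> real) set) \<Rightarrow> bool" where
  "indivisible ar P N \<longleftrightarrow>
     (\<forall>E. \<forall>p \<in> {..<ar E} \<rightarrow>\<^sub>E P. \<forall>a0 \<in> PiE {..<ar E} p. \<forall>a1 \<in> PiE {..<ar E} p.
        indicat_real (N E) a0 = indicat_real (N E) a1)"

end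

theory Submission
  imports Defs "HOL-Probability.Infinite_Product_Measure"
begin

text \<open>
  Only the VC-type consequence of the absence of branching is needed, and no removal lemma.
  If the slices \<open>E(s, _)\<close>, \<open>s \<in> [0,1]\<close>, of a relation in one coordinate cannot be covered, up to a set of
  small measure, by few balls of the \<open>L\<^sup>1\<close>-metric, then with probability bounded below a random sample
  of points \<open>s\<close> and of tuples for the other coordinates shows too many traces for Sauer's bound, so the
  finite structure induced on the sample has the branching property; by pigeonhole some minimal
  branching structure has positive density. Without branching, each coordinate of each relation
  therefore has few centres. Cutting the common refinement into pieces of equal measure and averaging
  the relation over the pieces, one coordinate at a time, moves it little in \<open>L\<^sup>1\<close>; rounding the
  averages gives \<open>M\<^sup>+\<close>. The number of parts is \<open>O(\<tau>/\<eta>)\<close> to a power linear in \<open>n * \<tau>\<close>, with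
  \<open>\<eta> = \<epsilon> / (6 * q * |L|)\<close>, which the stated bound dominates.
\<close>

section \<open>Sauer's bound for branching trees\<close>

text \<open>The hypothesis bounds densities only, so a given \<open>M\<close> may still contain
  trees of every depth on small sets, and \<open>\<delta>\<close> must be fixed before
  \<open>M\<close>. This forces a sample of fixed size \<open>N + s * k\<close>, on whose indices
  only finitely many structures exist. The two sizes pull against each other:
  \<open>(s + 1) ^ (\<tau> - 1) < N\<close> makes \<open>N\<close> traces on \<open>s\<close> tuples
  too many for Sauer's bound, while \<open>N ^ 2 * (1 - a) ^ s \<le> 1 / 2\<close> makes
  \<open>s\<close> tuples enough to tell \<open>N\<close> separated points apart. Both can hold
  because the bound is polynomial in \<open>s\<close> and the failure probability is exponential.

  The 6 in \<open>\<eta>\<close> arises as follows. The tolerance of a centre, the mass of points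
  without a near centre and the mass left over by the equal pieces are each
  \<open>\<eta> / 2\<close>. Comparing two points of one part doubles the sum
  \<open>3 * \<eta> / 2\<close>, and rounding doubles it again, which is \<open>6 * \<eta>\<close>
  per coordinate. The maximal arity and the number of symbols account for the rest of the
  denominator.\<close>

definition set_branching :: "nat \<Rightarrow> 'y set set \<Rightarrow> 'y set \<Rightarrow> bool" where
  "set_branching \<tau> \<A> Y \<longleftrightarrow>
     (\<exists>(a :: bool list \<Rightarrow> 'y set) (b :: bool list \<Rightarrow> 'y).
        (\<forall>i. length i = \<tau> \<longrightarrow> a i \<in> \<A>) \<and> (\<forall>j. length j < \<tau> \<longrightarrow> b j \<in> Y) \<and>
        (\<forall>i j h. length i = \<tau> \<longrightarrow> length j < \<tau> \<longrightarrow> prefix (j @ [h]) i \<longrightarrow> (b j \<in> a i \<longleftrightarrow> h)))"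

lemma set_branching_0: "\<A> \<noteq> {} \<Longrightarrow> set_branching 0 \<A> Y"
  unfolding set_branching_def by auto

text \<open>The point \<open>y\<close> becomes the root, and the head of a binary string selects the
  subtree: sets avoiding \<open>y\<close> below \<open>False\<close>, sets containing it below
  \<open>True\<close>. The largest depth of such a tree is known as the Littlestone dimension of the
  family.\<close>

lemma set_branching_Suc:
  assumes "y \<in> Y" "set_branching \<tau> {A \<in> \<A>. y \<notin> A} Y" "set_branching \<tau> {A \<in> \<A>. y \<in> A} Y"
  shows "set_branching (Suc \<tau>) \<A> Y"
proof -
  obtain a0 b0 where 0: "\<forall>i. length i = \<tau> \<longrightarrow> a0 i \<in> {A \<in> \<A>. y \<notin> A}" "\<forall>j. length j < \<tau> \<longrightarrow> b0 j \<in> Y"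
    "\<forall>i j h. length i = \<tau> \<longrightarrow> length j < \<tau> \<longrightarrow> prefix (j @ [h]) i \<longrightarrow> (b0 j \<in> a0 i \<longleftrightarrow> h)"
    using assms(2) unfolding set_branching_def by blast
  obtain a1 b1 where 1: "\<forall>i. length i = \<tau> \<longrightarrow> a1 i \<in> {A \<in> \<A>. y \<in> A}" "\<forall>j. length j < \<tau> \<longrightarrow> b1 j \<in> Y"
    "\<forall>i j h. length i = \<tau> \<longrightarrow> length j < \<tau> \<longrightarrow> prefix (j @ [h]) i \<longrightarrow> (b1 j \<in> a1 i \<longleftrightarrow> h)"
    using assms(3) unfolding set_branching_def by blast
  define a where "a i = (if hd i then a1 (tl i) else a0 (tl i))" for i
  define b where "b j = (if j = [] then y else if hd j then b1 (tl j) else b0 (tl j))" for j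
  have "a i \<in> \<A>" if "length i = Suc \<tau>" for i
    using that 0(1) 1(1) by (auto simp: a_def)
  moreover have "b j \<in> Y" if "length j < Suc \<tau>" for j
    using that 0(2) 1(2) assms(1) by (cases j) (auto simp: b_def)
  moreover have "b j \<in> a i \<longleftrightarrow> h"
    if ij: "length i = Suc \<tau>" "length j < Suc \<tau>" "prefix (j @ [h]) i" for i j h
  proof (cases j)
    case Nil
    then obtain i' where "i = h # i'" using ij(3) by (cases i) auto
    then show ?thesis using Nil ij 0(1) 1(1) by (auto simp: a_def b_def)
  next
    case (Cons h' j')
    then obtain i' where "i = h' # i'" "prefix (j' @ [h]) i'" using ij(3) by (cases i) auto
    then show ?thesis using Cons ij 0(3) 1(3) by (auto simp: a_def b_def)
  qed
  ultimately show ?thesis unfolding set_branching_def by blast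
qed

text \<open>A tree only asks about membership of its inner nodes, all in \<open>Y\<close>, so each
  leaf may be exchanged for a set with the same trace on \<open>Y\<close>. This restores the point
  \<open>y\<close> removed in Sauer's induction.\<close>

lemma set_branching_lift:
  assumes "set_branching \<tau> \<A> Y" "Y \<subseteq> Y'" "\<And>A. A \<in> \<A> \<Longrightarrow> \<exists>B\<in>\<B>. B \<inter> Y = A \<inter> Y"
  shows "set_branching \<tau> \<B> Y'"
proof -
  obtain a b where ab: "\<forall>i. length i = \<tau> \<longrightarrow> a i \<in> \<A>" "\<forall>j. length j < \<tau> \<longrightarrow> b j \<in> Y"
    "\<forall>i j h. length i = \<tau> \<longrightarrow> length j < \<tau> \<longrightarrow> prefix (j @ [h]) i \<longrightarrow> (b j \<in> a i \<longleftrightarrow> h)"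
    using assms(1) unfolding set_branching_def by blast
  obtain l where l: "\<And>A. A \<in> \<A> \<Longrightarrow> l A \<in> \<B> \<and> l A \<inter> Y = A \<inter> Y" using assms(3) by metis
  have "b j \<in> l (a i) \<longleftrightarrow> h" if "length i = \<tau>" "length j < \<tau>" "prefix (j @ [h]) i" for i j h
    using ab that l[of "a i"] by blast
  then show ?thesis unfolding set_branching_def using ab l assms(2)
    by (intro exI[of _ "l \<circ> a"] exI[of _ b]) (auto simp: o_def)
qed

text \<open>Sauer's induction: the sets that occur both with and without \<open>y\<close> carry a tree of
  depth one less on either side of \<open>y\<close>.\<close>

lemma set_branching_of_card:
  assumes "finite Y" "\<A> \<subseteq> Pow Y" "card \<A> > (card Y + 1) ^ (\<tau> - 1)"
  shows "set_branching \<tau> \<A> Y"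
  using assms
proof (induction Y arbitrary: \<A> \<tau>)
  case empty
  then have "card \<A> \<le> card {{} :: 'a set}" by (intro card_mono) auto
  with empty show ?case by simp
next
  case (insert y Y)
  show ?case
  proof (cases \<tau>)
    case 0
    then show ?thesis using insert.prems by (intro set_branching_0[of \<A>, folded 0]) auto
  next
    case (Suc t)
    define A0 where "A0 = {A \<in> \<A>. y \<notin> A}"
    define A1 where "A1 = (\<lambda>A. A - {y}) ` {A \<in> \<A>. y \<in> A}"
    have fin: "finite \<A>" using insert.prems insert.hyps(1) by (meson finite_Pow_iff finite_insert finite_subset)
    have sub: "A0 \<subseteq> Pow Y" "A1 \<subseteq> Pow Y" using insert.prems by (auto simp: A0_def A1_def)
    have "inj_on (\<lambda>A. A - {y}) {A \<in> \<A>. y \<in> A}" by (auto simp: inj_on_def)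
    then have "card A1 = card {A \<in> \<A>. y \<in> A}" unfolding A1_def by (rule card_image)
    moreover have "card \<A> = card {A \<in> \<A>. y \<notin> A} + card {A \<in> \<A>. y \<in> A}"
      using fin by (subst card_Un_disjoint[symmetric]) (auto intro: arg_cong[where f=card])
    moreover have "finite A0" "finite A1" using fin by (auto simp: A0_def A1_def)
    ultimately have card: "card \<A> = card (A0 \<union> A1) + card (A0 \<inter> A1)"
      using card_Un_Int[of A0 A1] by (simp only: A0_def[symmetric])
    \<comment> \<open>\<open>A0 \<union> A1\<close> consists of the traces on \<open>Y\<close>, and
      \<open>A0 \<inter> A1\<close> of the traces that extend both ways. Their sizes add up to
      \<open>card \<A>\<close>, so one of them exceeds its own bound: for depth
      \<open>\<tau>\<close> the union, for depth \<open>\<tau> - 1\<close> the intersection.\<close>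
    show ?thesis
    proof (cases "card (A0 \<union> A1) > (card Y + 1) ^ (\<tau> - 1)")
      case True
      then have "set_branching \<tau> (A0 \<union> A1) Y" using sub by (intro insert.IH) auto
      then show ?thesis
        by (rule set_branching_lift) (use insert.hyps in \<open>auto simp: A0_def A1_def\<close>)
    next
      case False
      have "card (A0 \<inter> A1) > (card Y + 2) ^ t - (card Y + 1) ^ t"
        using False insert.prems(2) insert.hyps card Suc power_mono[of "card Y + 1" "card Y + 2" t]
        by simp
      \<comment> \<open>The inequality \<open>(c + 1) ^ t - c ^ t \<ge> c ^ (t - 1)\<close> with
        \<open>c = card Y + 1\<close>. It fails for \<open>t = 0\<close>, where the truncated
        exponent is 0; there a nonempty intersection is all that a tree of depth 0 requires.\<close>
      moreover have "(card Y + 2) ^ t - (card Y + 1) ^ t \<ge> (card Y + 1) ^ (t - 1)" if "t \<noteq> 0"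
      proof -
        obtain u where u: "t = Suc u" using \<open>t \<noteq> 0\<close> not0_implies_Suc by blast
        have "(card Y + 2) * (card Y + 1) ^ u \<le> (card Y + 2) * (card Y + 2) ^ u"
          by (intro mult_left_mono power_mono) auto
        then show ?thesis using u by simp
      qed
      ultimately have br: "set_branching t (A0 \<inter> A1) Y"
        using sub by (cases "t = 0") (auto intro!: set_branching_0 insert.IH)
      show ?thesis unfolding Suc
      proof (rule set_branching_Suc[of y])
        show "set_branching t {A \<in> \<A>. y \<notin> A} (insert y Y)"
          by (rule set_branching_lift[OF br]) (auto simp: A0_def)
        show "set_branching t {A \<in> \<A>. y \<in> A} (insert y Y)"
          by (rule set_branching_lift[OF br]) (use insert.hyps in \<open>auto simp: A1_def\<close>)
      qed simp
    qed
  qed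
qed

section \<open>Averaging over one coordinate of the cube\<close>

abbreviation unit_measure :: "real measure" where
  "unit_measure \<equiv> restrict_space lborel {0..1}"

lemma space_unit [simp]: "space unit_measure = {0..1}"
  by (simp add: space_restrict_space)

lemma prob_space_unit: "prob_space unit_measure"
  by (rule prob_spaceI) (simp add: emeasure_restrict_space space_restrict_space)

interpretation unit: prob_space unit_measure by (rule prob_space_unit)

interpretation cube: product_prob_space "\<lambda>_::nat. unit_measure" UNIV
  by unfold_locales

lemma space_cube: "space (cube k) = {..<k} \<rightarrow>\<^sub>E {0..1}"
  by (simp add: cube_def space_PiM)

lemma prob_space_cube: "prob_space (cube k)"
  unfolding cube_def by (intro prob_space_PiM prob_space_unit)

interpretation cube_k: prob_space "cube k" for k by (rule prob_space_cube)

lemma measurable_cube_upd [measurable]: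
  assumes [measurable]: "f \<in> measurable N (cube k)" "g \<in> measurable N unit_measure" and "j < k"
  shows "(\<lambda>x. (f x)(j := g x)) \<in> measurable N (cube k)"
proof -
  have "(\<lambda>x. (f x)(j := g x)) \<in> measurable N (PiM (insert j {..<k}) (\<lambda>_. unit_measure))"
    using assms(1,2) unfolding cube_def by measurable
  moreover have "insert j {..<k} = {..<k}" using assms by auto
  ultimately show ?thesis by (simp add: cube_def)
qed

lemma measurable_cube_component [measurable]: "j < k \<Longrightarrow> (\<lambda>w. w j) \<in> measurable (cube k) unit_measure"
  unfolding cube_def by measurable

text \<open>By Fubini, coordinate \<open>j\<close> may be replaced by an independent uniform value,
  after which the outer integral ignores \<open>w j\<close>. Keeping the same cube on both sides
  avoids cubes whose index set has a gap.\<close>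

lemma nn_integral_resample:
  assumes [measurable]: "f \<in> borel_measurable (cube k)" and j: "j < k"
  shows "(\<integral>\<^sup>+w. f w \<partial>cube k) = (\<integral>\<^sup>+w. \<integral>\<^sup>+s. f (w(j := s)) \<partial>unit_measure \<partial>cube k)"
proof -
  let ?J = "{..<k} - {j}"
  have k: "cube k = PiM (insert j ?J) (\<lambda>_. unit_measure)"
    using j by (simp add: cube_def insert_absorb)
  have *: "(\<integral>\<^sup>+w. h w \<partial>cube k) = (\<integral>\<^sup>+x. \<integral>\<^sup>+s. h (x(j := s)) \<partial>unit_measure \<partial>PiM ?J (\<lambda>_. unit_measure))"
    if "h \<in> borel_measurable (cube k)" for h
    using that unfolding k by (intro cube.product_nn_integral_insert) auto
  have [measurable]: "(\<lambda>w. \<integral>\<^sup>+s. f (w(j := s)) \<partial>unit_measure) \<in> borel_measurable (cube k)"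
    using j by measurable
  show ?thesis
    by (subst (1 2) *) (simp_all add: unit.emeasure_space_1[simplified])
qed

text \<open>\<open>\<sigma>\<close> is a doubly stochastic kernel, \<open>f\<close> the function to
  be approximated and \<open>g\<close> the approximation so far. Integral 1 in the first argument
  makes averaging a contraction for the old error \<open>g - f\<close>; integral 1 in the second
  lets \<open>f w\<close> be written as an average of itself. The new error term involves
  \<open>f\<close> alone, so the errors of successive coordinates add up instead of
  compounding.\<close>

lemma averaging_step:
  fixes f g :: "(nat \<Rightarrow> real) \<Rightarrow> real" and \<sigma> :: "real \<Rightarrow> real \<Rightarrow> real"
  assumes j: "j < k"
    and f [measurable]: "f \<in> borel_measurable (cube k)" and f01: "\<And>w. f w \<in> {0..1}"
    and g [measurable]: "g \<in> borel_measurable (cube k)" and g01: "\<And>w. g w \<in> {0..1}"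
    and \<sigma> [measurable]: "case_prod \<sigma> \<in> borel_measurable (unit_measure \<Otimes>\<^sub>M unit_measure)"
    and \<sigma>0: "\<And>s t. 0 \<le> \<sigma> s t"
    and \<sigma>1: "\<And>s. s \<in> {0..1} \<Longrightarrow> (\<integral>\<^sup>+t. ennreal (\<sigma> s t) \<partial>unit_measure) = 1"
    and \<sigma>2: "\<And>t. t \<in> {0..1} \<Longrightarrow> (\<integral>\<^sup>+s. ennreal (\<sigma> s t) \<partial>unit_measure) = 1"
  defines "A \<equiv> \<lambda>w. if w \<in> space (cube k) then \<integral>t. \<sigma> (w j) t * g (w(j := t)) \<partial>unit_measure else 0"
  shows "A \<in> borel_measurable (cube k)" and "A w \<in> {0..1}"
    and "(\<integral>\<^sup>+w. ennreal \<bar>A w - f w\<bar> \<partial>cube k) \<le> (\<integral>\<^sup>+w. ennreal \<bar>g w - f w\<bar> \<partial>cube k) +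
      (\<integral>\<^sup>+s. \<integral>\<^sup>+t. ennreal (\<sigma> s t) * (\<integral>\<^sup>+w. ennreal \<bar>f (w(j := t)) - f (w(j := s))\<bar> \<partial>cube k)
         \<partial>unit_measure \<partial>unit_measure)"
proof -
  note [measurable] = j
  have "(\<lambda>w. \<integral>t. \<sigma> (w j) t * g (w(j := t)) \<partial>unit_measure) \<in> borel_measurable (cube k)"
    by measurable
  then show A [measurable]: "A \<in> borel_measurable (cube k)"
    unfolding A_def by (simp cong: measurable_cong)
  have wj: "w j \<in> {0..1}" if "w \<in> space (cube k)" for w
    using that j by (auto simp: space_cube PiE_iff)
  have wt: "w(j := t) \<in> space (cube k)" if "w \<in> space (cube k)" "t \<in> {0..1}" for w t
    using that j by (auto simp: space_cube PiE_iff extensional_def)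
  have int: "integrable unit_measure (\<lambda>t. \<sigma> s t)" if "s \<in> {0..1}" for s
    using that \<sigma>1[OF that] \<sigma>0 by (intro integrableI_bounded) auto
  have int1: "(\<integral>t. \<sigma> s t \<partial>unit_measure) = 1" if "s \<in> {0..1}" for s
    using that \<sigma>1[OF that] \<sigma>0 by (subst integral_eq_nn_integral) auto
  have intg: "integrable unit_measure (\<lambda>t. \<sigma> (w j) t * g (w(j := t)))" if w: "w \<in> space (cube k)" for w
  proof (rule Bochner_Integration.integrable_bound[OF int[OF wj[OF w]]])
    show "(\<lambda>t. \<sigma> (w j) t * g (w(j := t))) \<in> borel_measurable unit_measure"
    proof -
      have [measurable]: "w \<in> space (cube k)" "w j \<in> space unit_measure" using w wj by auto
      show ?thesis by measurable
    qed
    show "AE t in unit_measure. norm (\<sigma> (w j) t * g (w(j := t))) \<le> norm (\<sigma> (w j) t)"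
      using \<sigma>0 g01 by (auto simp: abs_mult intro!: mult_left_le)
  qed
  show "A w \<in> {0..1}"
  proof (cases "w \<in> space (cube k)")
    case True
    have "(\<integral>t. \<sigma> (w j) t * g (w(j := t)) \<partial>unit_measure) \<le> (\<integral>t. \<sigma> (w j) t \<partial>unit_measure)"
      using \<sigma>0 g01 by (intro integral_mono intg int wj True) (auto intro!: mult_left_le)
    then show ?thesis using True int1[OF wj[OF True]] \<sigma>0 g01
      by (auto simp: A_def intro!: integral_nonneg_AE)
  qed (simp add: A_def)
  \<comment> \<open>The comparison passes through \<open>f (w(j := t))\<close>: one term is the old
    error at the resampled point, the other the movement of \<open>f\<close> itself.\<close>
  have ptw: "ennreal \<bar>A w - f w\<bar> \<le>
      (\<integral>\<^sup>+t. ennreal (\<sigma> (w j) t) * ennreal \<bar>g (w(j := t)) - f (w(j := t))\<bar> \<partial>unit_measure) +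
      (\<integral>\<^sup>+t. ennreal (\<sigma> (w j) t) * ennreal \<bar>f (w(j := t)) - f w\<bar> \<partial>unit_measure)"
    if w: "w \<in> space (cube k)" for w
  proof -
    have [measurable]: "w \<in> space (cube k)" "w j \<in> space unit_measure" using w wj by auto
    have "A w - f w = (\<integral>t. \<sigma> (w j) t * g (w(j := t)) \<partial>unit_measure) - (\<integral>t. \<sigma> (w j) t * f w \<partial>unit_measure)"
      using w int1[OF wj[OF w]] by (simp add: A_def)
    also have "\<dots> = (\<integral>t. \<sigma> (w j) t * g (w(j := t)) - \<sigma> (w j) t * f w \<partial>unit_measure)"
      by (rule Bochner_Integration.integral_diff[symmetric]) (use w intg int wj in auto)
    finally have "ennreal \<bar>A w - f w\<bar> = ennreal (norm (\<integral>t. \<sigma> (w j) t * g (w(j := t)) - \<sigma> (w j) t * f w \<partial>unit_measure))"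
      by simp
    also have "\<dots> \<le> (\<integral>\<^sup>+t. norm (\<sigma> (w j) t * g (w(j := t)) - \<sigma> (w j) t * f w) \<partial>unit_measure)"
      by (rule integral_norm_bound_ennreal)
         (intro Bochner_Integration.integrable_diff intg integrable_mult_left int wj w)
    also have "\<dots> \<le> (\<integral>\<^sup>+t. ennreal (\<sigma> (w j) t) * ennreal \<bar>g (w(j := t)) - f (w(j := t))\<bar> +
        ennreal (\<sigma> (w j) t) * ennreal \<bar>f (w(j := t)) - f w\<bar> \<partial>unit_measure)"
    proof (rule nn_integral_mono)
      fix t
      have "\<bar>g (w(j := t)) - f w\<bar> \<le> \<bar>g (w(j := t)) - f (w(j := t))\<bar> + \<bar>f (w(j := t)) - f w\<bar>" by simp
      then have "\<sigma> (w j) t * \<bar>g (w(j := t)) - f w\<bar> \<le>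
          \<sigma> (w j) t * (\<bar>g (w(j := t)) - f (w(j := t))\<bar> + \<bar>f (w(j := t)) - f w\<bar>)"
        by (rule mult_left_mono[OF _ \<sigma>0])
      moreover have "norm (\<sigma> (w j) t * g (w(j := t)) - \<sigma> (w j) t * f w) = \<sigma> (w j) t * \<bar>g (w(j := t)) - f w\<bar>"
        using \<sigma>0[of "w j" t] by (simp add: right_diff_distrib[symmetric] abs_mult)
      ultimately show "ennreal (norm (\<sigma> (w j) t * g (w(j := t)) - \<sigma> (w j) t * f w)) \<le>
         ennreal (\<sigma> (w j) t) * ennreal \<bar>g (w(j := t)) - f (w(j := t))\<bar> +
         ennreal (\<sigma> (w j) t) * ennreal \<bar>f (w(j := t)) - f w\<bar>"
        using \<sigma>0 by (simp add: ennreal_mult[symmetric] ennreal_plus[symmetric] distrib_left del: ennreal_plus)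
    qed
    also have "\<dots> = (\<integral>\<^sup>+t. ennreal (\<sigma> (w j) t) * ennreal \<bar>g (w(j := t)) - f (w(j := t))\<bar> \<partial>unit_measure) +
      (\<integral>\<^sup>+t. ennreal (\<sigma> (w j) t) * ennreal \<bar>f (w(j := t)) - f w\<bar> \<partial>unit_measure)"
      by (rule nn_integral_add) measurable
    finally show ?thesis .
  qed
  have "(\<integral>\<^sup>+w. ennreal \<bar>A w - f w\<bar> \<partial>cube k) \<le>
      (\<integral>\<^sup>+w. (\<integral>\<^sup>+t. ennreal (\<sigma> (w j) t) * ennreal \<bar>g (w(j := t)) - f (w(j := t))\<bar> \<partial>unit_measure) +
      (\<integral>\<^sup>+t. ennreal (\<sigma> (w j) t) * ennreal \<bar>f (w(j := t)) - f w\<bar> \<partial>unit_measure) \<partial>cube k)"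
    by (rule nn_integral_mono) (rule ptw)
  also have "\<dots> = (\<integral>\<^sup>+w. \<integral>\<^sup>+t. ennreal (\<sigma> (w j) t) * ennreal \<bar>g (w(j := t)) - f (w(j := t))\<bar> \<partial>unit_measure \<partial>cube k) +
      (\<integral>\<^sup>+w. \<integral>\<^sup>+t. ennreal (\<sigma> (w j) t) * ennreal \<bar>f (w(j := t)) - f w\<bar> \<partial>unit_measure \<partial>cube k)"
    by (rule nn_integral_add) measurable
  \<comment> \<open>The weight depends on \<open>w j\<close>, the error does not. Resampling
    \<open>w j\<close> as \<open>s\<close> therefore allows \<open>\<sigma>\<close> to be integrated
    out by \<open>\<sigma>2\<close>.\<close>
  also have "(\<integral>\<^sup>+w. \<integral>\<^sup>+t. ennreal (\<sigma> (w j) t) * ennreal \<bar>g (w(j := t)) - f (w(j := t))\<bar> \<partial>unit_measure \<partial>cube k)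
      = (\<integral>\<^sup>+w. ennreal \<bar>g w - f w\<bar> \<partial>cube k)"
  proof -
    have "(\<integral>\<^sup>+w. \<integral>\<^sup>+t. ennreal (\<sigma> (w j) t) * ennreal \<bar>g (w(j := t)) - f (w(j := t))\<bar> \<partial>unit_measure \<partial>cube k)
      = (\<integral>\<^sup>+w. \<integral>\<^sup>+s. \<integral>\<^sup>+t. ennreal (\<sigma> s t) * ennreal \<bar>g (w(j := t)) - f (w(j := t))\<bar> \<partial>unit_measure \<partial>unit_measure \<partial>cube k)"
      by (subst nn_integral_resample[OF _ j]) (simp_all del: fun_upd_apply add: fun_upd_same)
    also have "\<dots> = (\<integral>\<^sup>+w. \<integral>\<^sup>+t. \<integral>\<^sup>+s. ennreal (\<sigma> s t) * ennreal \<bar>g (w(j := t)) - f (w(j := t))\<bar> \<partial>unit_measure \<partial>unit_measure \<partial>cube k)"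
    proof (rule nn_integral_cong)
      fix w assume [measurable]: "w \<in> space (cube k)"
      interpret pair_sigma_finite unit_measure unit_measure ..
      show "(\<integral>\<^sup>+s. \<integral>\<^sup>+t. ennreal (\<sigma> s t) * ennreal \<bar>g (w(j := t)) - f (w(j := t))\<bar> \<partial>unit_measure \<partial>unit_measure)
        = (\<integral>\<^sup>+t. \<integral>\<^sup>+s. ennreal (\<sigma> s t) * ennreal \<bar>g (w(j := t)) - f (w(j := t))\<bar> \<partial>unit_measure \<partial>unit_measure)"
        by (rule Fubini'[symmetric]) measurable
    qed
    also have "\<dots> = (\<integral>\<^sup>+w. \<integral>\<^sup>+t. ennreal \<bar>g (w(j := t)) - f (w(j := t))\<bar> \<partial>unit_measure \<partial>cube k)"
      by (intro nn_integral_cong) (simp add: nn_integral_multc \<sigma>2)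
    also have "\<dots> = (\<integral>\<^sup>+w. ennreal \<bar>g w - f w\<bar> \<partial>cube k)"
      by (rule nn_integral_resample[symmetric]) (use j in measurable)
    finally show ?thesis .
  qed
  \<comment> \<open>Here resampling turns both occurrences of \<open>w j\<close> into
    \<open>s\<close>; integrating over \<open>w\<close> innermost then leaves the distance between
    the slices at \<open>s\<close> and \<open>t\<close>.\<close>
  also have "(\<integral>\<^sup>+w. \<integral>\<^sup>+t. ennreal (\<sigma> (w j) t) * ennreal \<bar>f (w(j := t)) - f w\<bar> \<partial>unit_measure \<partial>cube k)
    = (\<integral>\<^sup>+s. \<integral>\<^sup>+t. ennreal (\<sigma> s t) * (\<integral>\<^sup>+w. ennreal \<bar>f (w(j := t)) - f (w(j := s))\<bar> \<partial>cube k)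
         \<partial>unit_measure \<partial>unit_measure)"
  proof -
    interpret pair_sigma_finite "cube k" unit_measure ..
    have "(\<integral>\<^sup>+w. \<integral>\<^sup>+t. ennreal (\<sigma> (w j) t) * ennreal \<bar>f (w(j := t)) - f w\<bar> \<partial>unit_measure \<partial>cube k)
      = (\<integral>\<^sup>+w. \<integral>\<^sup>+s. \<integral>\<^sup>+t. ennreal (\<sigma> s t) * ennreal \<bar>f (w(j := t)) - f (w(j := s))\<bar> \<partial>unit_measure \<partial>unit_measure \<partial>cube k)"
      by (subst nn_integral_resample[OF _ j]) (simp_all del: fun_upd_apply add: fun_upd_same)
    also have "\<dots> = (\<integral>\<^sup>+s. \<integral>\<^sup>+w. \<integral>\<^sup>+t. ennreal (\<sigma> s t) * ennreal \<bar>f (w(j := t)) - f (w(j := s))\<bar> \<partial>unit_measure \<partial>cube k \<partial>unit_measure)"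
      by (rule Fubini'[symmetric]) measurable
    also have "\<dots> = (\<integral>\<^sup>+s. \<integral>\<^sup>+t. \<integral>\<^sup>+w. ennreal (\<sigma> s t) * ennreal \<bar>f (w(j := t)) - f (w(j := s))\<bar> \<partial>cube k \<partial>unit_measure \<partial>unit_measure)"
    proof (rule nn_integral_cong)
      fix s assume [measurable]: "s \<in> space unit_measure"
      show "(\<integral>\<^sup>+w. \<integral>\<^sup>+t. ennreal (\<sigma> s t) * ennreal \<bar>f (w(j := t)) - f (w(j := s))\<bar> \<partial>unit_measure \<partial>cube k)
        = (\<integral>\<^sup>+t. \<integral>\<^sup>+w. ennreal (\<sigma> s t) * ennreal \<bar>f (w(j := t)) - f (w(j := s))\<bar> \<partial>cube k \<partial>unit_measure)"
        by (rule Fubini'[symmetric]) measurable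
    qed
    also have "\<dots> = (\<integral>\<^sup>+s. \<integral>\<^sup>+t. ennreal (\<sigma> s t) * (\<integral>\<^sup>+w. ennreal \<bar>f (w(j := t)) - f (w(j := s))\<bar> \<partial>cube k)
         \<partial>unit_measure \<partial>unit_measure)"
      by (intro nn_integral_cong nn_integral_cmult) measurable
    finally show ?thesis .
  qed
  finally show "(\<integral>\<^sup>+w. ennreal \<bar>A w - f w\<bar> \<partial>cube k) \<le> (\<integral>\<^sup>+w. ennreal \<bar>g w - f w\<bar> \<partial>cube k) +
      (\<integral>\<^sup>+s. \<integral>\<^sup>+t. ennreal (\<sigma> s t) * (\<integral>\<^sup>+w. ennreal \<bar>f (w(j := t)) - f (w(j := s))\<bar> \<partial>cube k)
         \<partial>unit_measure \<partial>unit_measure)" .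
qed

section \<open>Equitable partitions and step approximations\<close>

lemma fmeasurable_unit_subset: "A \<in> sets borel \<Longrightarrow> A \<subseteq> {0..1::real} \<Longrightarrow> A \<in> fmeasurable lborel"
  by (rule fmeasurableI2[of "{0..1}"]) (simp_all add: fmeasurableI)

text \<open>The measure of the part of \<open>A\<close> up to \<open>t\<close> is a 1-Lipschitz
  function of \<open>t\<close>, so the intermediate value theorem applies.\<close>

lemma exists_borel_subset_measure:
  assumes A: "A \<in> sets borel" "A \<subseteq> {0..1::real}" and c: "0 \<le> c" "c \<le> measure lborel A"
  shows "\<exists>B\<subseteq>A. B \<in> sets borel \<and> measure lborel B = c"
proof -
  define h where "h t = measure lborel (A \<inter> {0..t})" for t
  have fm: "A \<inter> {0..t} \<in> fmeasurable lborel" for t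
    using A by (intro fmeasurable_unit_subset) auto
  have lip: "\<bar>h t - h s\<bar> \<le> \<bar>t - s\<bar>" for s t
  proof -
    have *: "h t - h s \<le> t - s" if "s \<le> t" for s t
    proof -
      have "h t \<le> measure lborel ((A \<inter> {0..s}) \<union> {s..t})"
        unfolding h_def
      proof (rule measure_mono_fmeasurable)
        show "A \<inter> {0..s} \<union> {s..t} \<in> fmeasurable lborel"
          by (intro fmeasurable.Un fm fmeasurableI) (simp_all add: that)
      qed (use A in auto)
      also have "\<dots> \<le> h s + measure lborel {s..t}"
        unfolding h_def using A by (intro measure_Un_le) auto
      finally show ?thesis using that by simp
    qed
    have mono: "h s \<le> h t" if "s \<le> t" for s t
      unfolding h_def by (rule measure_mono_fmeasurable) (use that fm A in auto)
    show ?thesis using *[of s t] *[of t s] mono[of s t] mono[of t s] by (cases "s \<le> t") auto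
  qed
  have "continuous_on {0..1} h"
  proof (rule continuous_onI)
    fix x e :: real assume "e > 0"
    then show "\<exists>d>0. \<forall>x'\<in>{0..1}. dist x' x < d \<longrightarrow> dist (h x') (h x) \<le> e"
      using lip order.trans[OF lip less_imp_le] by (intro exI[of _ e]) (simp add: dist_real_def)
  qed
  moreover have "h 0 \<le> c"
  proof -
    have "h 0 \<le> measure lborel {0::real}"
      unfolding h_def by (rule measure_mono_fmeasurable) (use A in \<open>auto intro: fmeasurableI\<close>)
    then show ?thesis using c by simp
  qed
  moreover have "c \<le> h 1" using A c by (simp add: h_def Int_absorb2)
  ultimately obtain t where "h t = c" by (meson IVT' zero_le_one)
  then show ?thesis using A by (intro exI[of _ "A \<inter> {0..t}"]) (auto simp: h_def)
qed

text \<open>Pieces are cut off inside a fibre of \<open>\<kappa>\<close> as long as some fibre is large enough; then the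
  remainder \<open>U\<close> has measure at most \<open>card V * c\<close>.\<close>

lemma equitable_pieces:
  fixes \<kappa> :: "real \<Rightarrow> 'b"
  assumes "0 < c" "A \<in> sets borel" "A \<subseteq> {0..1}" "measure lborel A = real (Suc r) * c"
    and "finite V" "\<kappa> ` A \<subseteq> V" and "\<And>v. v \<in> V \<Longrightarrow> {x \<in> {0..1}. \<kappa> x = v} \<in> sets borel"
  shows "\<exists>P U. partition_on A P \<and> finite P \<and> card P = Suc r \<and> P \<subseteq> sets borel \<and>
     (\<forall>p\<in>P. measure lborel p = c) \<and> U \<in> sets borel \<and> U \<subseteq> A \<and> measure lborel U \<le> real (card V) * c \<and>
     (\<forall>p\<in>P. p \<subseteq> U \<or> (\<exists>v. \<forall>x\<in>p. \<kappa> x = v))"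
  using assms(2,3,4,6)
proof (induction r arbitrary: A)
  case 0
  then have "A \<noteq> {}" using assms(1) by auto
  then have "V \<noteq> {}" using 0 by auto
  then have "card V \<ge> 1" using assms(5) by (simp add: Suc_leI card_gt_0_iff)
  then have "real (card V) * c \<ge> c" using assms(1) by (simp add: mult_le_cancel_right1)
  \<comment> \<open>The last piece need not lie in a fibre, so it is declared leftover; its measure
    \<open>c\<close> is within the bound because \<open>V\<close> is nonempty.\<close>
  then show ?case using 0 \<open>A \<noteq> {}\<close>
    by (intro exI[of _ "{A}"] exI[of _ A]) (auto simp: partition_on_def disjoint_def)
next
  case (Suc r)
  have fm: "X \<in> fmeasurable lborel" if "X \<in> sets borel" "X \<subseteq> A" for X
    using that Suc.prems by (intro fmeasurable_unit_subset) auto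
  have c_le: "c \<le> measure lborel A" using Suc.prems(3) assms(1) by (simp add: algebra_simps)
  have "\<exists>B. B \<subseteq> A \<and> B \<in> sets borel \<and> measure lborel B = c \<and>
    ((\<exists>v. \<forall>x\<in>B. \<kappa> x = v) \<or> measure lborel A \<le> real (card V) * c)"
  proof (cases "\<exists>v\<in>V. c \<le> measure lborel (A \<inter> {x \<in> {0..1}. \<kappa> x = v})")
    case True
    then obtain v where v: "v \<in> V" "c \<le> measure lborel (A \<inter> {x \<in> {0..1}. \<kappa> x = v})" by blast
    obtain B where B: "B \<subseteq> A \<inter> {x \<in> {0..1}. \<kappa> x = v}" "B \<in> sets borel" "measure lborel B = c"
      using exists_borel_subset_measure[of "A \<inter> {x \<in> {0..1}. \<kappa> x = v}" c] v assms(1,7) Suc.prems by auto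
    moreover have "\<forall>x\<in>B. \<kappa> x = v" using B(1) by blast
    ultimately show ?thesis by blast
  next
    case False
    have "A = (\<Union>v\<in>V. A \<inter> {x \<in> {0..1}. \<kappa> x = v})" using Suc.prems(2,4) by blast
    then have "measure lborel A = measure lborel (\<Union>v\<in>V. A \<inter> {x \<in> {0..1}. \<kappa> x = v})" by (rule arg_cong)
    also have "\<dots> \<le> (\<Sum>v\<in>V. measure lborel (A \<inter> {x \<in> {0..1}. \<kappa> x = v}))"
      using assms(5,7) Suc.prems by (intro measure_UNION_le) auto
    also have "\<dots> \<le> (\<Sum>v\<in>V. c)" using False by (intro sum_mono) auto
    finally have "measure lborel A \<le> real (card V) * c" by simp
    then show ?thesis using exists_borel_subset_measure[of A c] Suc.prems c_le assms(1) by auto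
  qed
  then obtain B where B: "B \<subseteq> A" "B \<in> sets borel" "measure lborel B = c"
    "(\<exists>v. \<forall>x\<in>B. \<kappa> x = v) \<or> measure lborel A \<le> real (card V) * c" by blast
  have "measure lborel (A - B) = measure lborel A - measure lborel B"
    using B Suc.prems by (intro measurable_measure_Diff fm) auto
  then have mAB: "measure lborel (A - B) = real (Suc r) * c"
    using B(3) Suc.prems(3) by (simp add: algebra_simps)
  have "A - B \<in> sets borel" "A - B \<subseteq> {0..1}" "\<kappa> ` (A - B) \<subseteq> V" using B(1,2) Suc.prems by auto
  from Suc.IH[OF this(1,2) mAB this(3)] obtain P U where PU: "partition_on (A - B) P" "finite P" "card P = Suc r" "P \<subseteq> sets borel"
     "\<forall>p\<in>P. measure lborel p = c" "U \<in> sets borel" "U \<subseteq> A - B" "measure lborel U \<le> real (card V) * c"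
     "\<forall>p\<in>P. p \<subseteq> U \<or> (\<exists>v. \<forall>x\<in>p. \<kappa> x = v)"
    by blast
  have Bne: "B \<noteq> {}" using B assms(1) by auto
  have sub: "p \<subseteq> A - B" if "p \<in> P" for p using PU(1) that by (auto simp: partition_on_def)
  have BP: "B \<notin> P" using sub Bne by blast
  have part: "partition_on A (insert B P)"
    using PU(1) B(1) Bne sub by (subst partition_on_insert) (auto simp: disjnt_def)
  have "\<exists>W. W \<in> sets borel \<and> W \<subseteq> A \<and> measure lborel W \<le> real (card V) * c \<and>
     (\<forall>p\<in>insert B P. p \<subseteq> W \<or> (\<exists>v. \<forall>x\<in>p. \<kappa> x = v))"
  proof (cases "\<exists>v. \<forall>x\<in>B. \<kappa> x = v")
    case True
    then show ?thesis using PU(6-9) by (intro exI[of _ U]) blast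
  next
    case False
    \<comment> \<open>Here \<open>B\<close> was cut off when no fibre was large enough. The whole
      current set \<open>A\<close> is then already small, and it replaces the leftover
      \<open>U\<close> of the later pieces.\<close>
    have "p \<subseteq> A" if "p \<in> insert B P" for p using that sub B(1) by blast
    then show ?thesis using False B(4) Suc.prems(1) by (intro exI[of _ A]) blast
  qed
  then obtain W where W: "W \<in> sets borel" "W \<subseteq> A" "measure lborel W \<le> real (card V) * c"
     "\<forall>p\<in>insert B P. p \<subseteq> W \<or> (\<exists>v. \<forall>x\<in>p. \<kappa> x = v)" by blast
  have "finite (insert B P)" "card (insert B P) = Suc (Suc r)" "insert B P \<subseteq> sets borel"
    "\<forall>p\<in>insert B P. measure lborel p = c"
    using PU(2-5) BP B(2,3) by simp_all
  with part W show ?case by blast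
qed

text \<open>This is the \<open>L\<^sup>1\<close>-distance between the slices of \<open>M\<close> at
  \<open>s\<close> and at \<open>t\<close> in coordinate \<open>j\<close>. The integral runs over
  all \<open>k\<close> coordinates although \<open>w j\<close> is overwritten; that coordinate
  contributes a factor 1.\<close>

definition slice_dist :: "nat \<Rightarrow> (nat \<Rightarrow> real) set \<Rightarrow> nat \<Rightarrow> real \<Rightarrow> real \<Rightarrow> ennreal" where
  "slice_dist k M j s t =
     (\<integral>\<^sup>+w. ennreal \<bar>indicat_real M (w(j := t)) - indicat_real M (w(j := s))\<bar> \<partial>cube k)"

lemma slice_dist_sym: "slice_dist k M j s t = slice_dist k M j t s"
  by (simp add: slice_dist_def abs_minus_commute)

lemma measurable_slice_dist [measurable]:
  assumes [measurable]: "M \<in> sets (cube k)" "f \<in> measurable N unit_measure" "g \<in> measurable N unit_measure" "j < k"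
  shows "(\<lambda>x. slice_dist k M j (f x) (g x)) \<in> borel_measurable N"
  unfolding slice_dist_def by measurable

lemma slice_dist_le_1: "slice_dist k M j s t \<le> 1"
proof -
  have "slice_dist k M j s t \<le> (\<integral>\<^sup>+w. 1 \<partial>cube k)"
    unfolding slice_dist_def by (intro nn_integral_mono) (auto simp: indicator_def)
  then show ?thesis by (simp add: cube_k.emeasure_space_1)
qed

lemma slice_dist_triangle:
  assumes [measurable]: "M \<in> sets (cube k)" "j < k" and "s \<in> {0..1}" "t \<in> {0..1}" "u \<in> {0..1}"
  shows "slice_dist k M j s t \<le> slice_dist k M j s u + slice_dist k M j u t"
proof -
  have [measurable]: "s \<in> space unit_measure" "t \<in> space unit_measure" "u \<in> space unit_measure" using assms by auto
  have "slice_dist k M j s t \<le> (\<integral>\<^sup>+w. ennreal \<bar>indicat_real M (w(j := u)) - indicat_real M (w(j := s))\<bar>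
     + ennreal \<bar>indicat_real M (w(j := t)) - indicat_real M (w(j := u))\<bar> \<partial>cube k)"
    unfolding slice_dist_def by (intro nn_integral_mono) (auto simp flip: ennreal_plus)
  also have "\<dots> = slice_dist k M j s u + slice_dist k M j u t"
    unfolding slice_dist_def by (rule nn_integral_add) measurable
  finally show ?thesis .
qed

text \<open>Each coordinate costs \<open>2 * (\<theta> + u)\<close>: two points of one part share
  their centre unless the part lies in \<open>U\<close>, so the distance of their slices is at most
  the sum of the distances to that centre. Rounding the averaged function at 1/2 doubles the
  total.\<close>

lemma step_set_approximation:
  fixes M :: "(nat \<Rightarrow> real) set" and P :: "real set set" and c :: "nat \<Rightarrow> real \<Rightarrow> real"
  assumes M [measurable]: "M \<in> sets (cube k)"
    and P: "partition_on {0..1} P" "finite P" "P \<subseteq> sets borel"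
    and Pm: "\<And>p. p \<in> P \<Longrightarrow> emeasure lborel p = ennreal (1 / m)" and m: "0 < m"
    and U: "U \<in> sets borel" "U \<subseteq> {0..1}" "emeasure lborel U \<le> ennreal u" and u: "0 \<le> u"
    and c: "\<And>j. j < k \<Longrightarrow> c j \<in> measurable unit_measure unit_measure"
    and c_int: "\<And>j. j < k \<Longrightarrow> (\<integral>\<^sup>+s. slice_dist k M j s (c j s) \<partial>unit_measure) \<le> ennreal \<theta>" and \<theta>: "0 \<le> \<theta>"
    and c_const: "\<And>p j. p \<in> P \<Longrightarrow> j < k \<Longrightarrow> p \<subseteq> U \<or> (\<exists>v. \<forall>x\<in>p. c j x = v)"
  shows "\<exists>N\<in>sets (cube k). (\<forall>p\<in>{..<k} \<rightarrow>\<^sub>E P. \<forall>x\<in>PiE {..<k} p. \<forall>y\<in>PiE {..<k} p. x \<in> N \<longleftrightarrow> y \<in> N) \<and>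
     (\<integral>\<^sup>+w. ennreal \<bar>indicat_real M w - indicat_real N w\<bar> \<partial>cube k) \<le> ennreal (4 * real k * (\<theta> + u))"
proof -
  \<comment> \<open>Integrating against this kernel averages over the part containing
    \<open>s\<close>; the parts have measure \<open>1 / m\<close>, whence the factor
    \<open>m\<close>. By symmetry one computation gives both marginals.\<close>
  define \<sigma> where "\<sigma> s t = m * (\<Sum>p\<in>P. indicat_real p s * indicat_real p t)" for s t
  have [measurable]: "indicat_real p \<in> borel_measurable unit_measure" if "p \<in> P" for p
    using that P by (intro measurable_restrict_space1) auto
  have \<sigma>_meas [measurable]: "case_prod \<sigma> \<in> borel_measurable (unit_measure \<Otimes>\<^sub>M unit_measure)"
    unfolding \<sigma>_def by measurable
  have \<sigma>_nonneg: "0 \<le> \<sigma> s t" for s t unfolding \<sigma>_def using m by (intro mult_nonneg_nonneg sum_nonneg) auto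
  have \<sigma>_sym: "\<sigma> s t = \<sigma> t s" for s t by (simp add: \<sigma>_def mult.commute)
  have \<sigma>_eq: "\<sigma> s t = m * indicat_real p t" if "p \<in> P" "s \<in> p" for p s t
  proof -
    have uniq: "q = p" if "q \<in> P" "s \<in> q" for q
      using disjointD[OF partition_onD2[OF P(1)] \<open>q \<in> P\<close> \<open>p \<in> P\<close>] \<open>s \<in> p\<close> that by blast
    have "(\<Sum>q\<in>P. indicat_real q s * indicat_real q t) = (\<Sum>q\<in>P. if q = p then indicat_real p t else 0)"
    proof (rule sum.cong[OF refl])
      fix q assume "q \<in> P"
      then show "indicat_real q s * indicat_real q t = (if q = p then indicat_real p t else 0)"
        using uniq[OF \<open>q \<in> P\<close>] \<open>s \<in> p\<close> by (cases "s \<in> q") auto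
    qed
    then show ?thesis using \<open>p \<in> P\<close> P(2) by (simp add: \<sigma>_def)
  qed
  have ex_p: "\<exists>p\<in>P. s \<in> p" if "s \<in> {0..1}" for s
    using that partition_onD1[OF P(1)] by auto
  have sub: "p \<subseteq> {0..1}" if "p \<in> P" for p
    using that partition_onD1[OF P(1)] by auto
  have \<sigma>1: "(\<integral>\<^sup>+t. ennreal (\<sigma> s t) \<partial>unit_measure) = 1" if s: "s \<in> {0..1}" for s
  proof -
    obtain p where p: "p \<in> P" "s \<in> p" using ex_p[OF s] by blast
    have "p \<in> sets unit_measure" using p P(3) sub by (auto simp: sets_restrict_space_iff)
    have "(\<integral>\<^sup>+t. ennreal (\<sigma> s t) \<partial>unit_measure) = (\<integral>\<^sup>+t. ennreal m * indicator p t \<partial>unit_measure)"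
      using m by (intro nn_integral_cong) (simp add: \<sigma>_eq[OF p] indicator_def)
    also have "\<dots> = ennreal m * emeasure unit_measure p"
      using \<open>p \<in> sets unit_measure\<close> by (rule nn_integral_cmult_indicator)
    also have "emeasure unit_measure p = ennreal (1 / m)"
      using p sub by (simp add: emeasure_restrict_space Pm)
    finally show ?thesis using m by (simp add: ennreal_mult[symmetric])
  qed
  have \<sigma>2: "(\<integral>\<^sup>+s. ennreal (\<sigma> s t) \<partial>unit_measure) = 1" if t: "t \<in> {0..1}" for t
    unfolding \<sigma>_sym[of _ t] by (rule \<sigma>1[OF t])
  define f where "f = indicat_real M"
  have f [measurable]: "f \<in> borel_measurable (cube k)" unfolding f_def by measurable
  define same where "same s t \<longleftrightarrow> (\<exists>p\<in>P. s \<in> p \<and> t \<in> p)" for s t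
  have slice: "(\<integral>\<^sup>+s. \<integral>\<^sup>+t. ennreal (\<sigma> s t) * slice_dist k M j s t \<partial>unit_measure \<partial>unit_measure)
     \<le> ennreal (2 * (\<theta> + u))" if j: "j < k" for j
  proof -
    note [measurable] = j c[OF j]
    have [measurable]: "(indicator U :: real \<Rightarrow> ennreal) \<in> borel_measurable unit_measure"
      using U by (intro measurable_restrict_space1) auto
    \<comment> \<open>Each point is charged its distance to its centre, and on \<open>U\<close>,
      where centres may vary within a part, also the maximal distance 1.\<close>
    define e where "e s = slice_dist k M j s (c j s) + indicator U s" for s
    have [measurable]: "e \<in> borel_measurable unit_measure" unfolding e_def by measurable
    have e: "ennreal (\<sigma> s t) * slice_dist k M j s t \<le> ennreal (\<sigma> s t) * e s + ennreal (\<sigma> s t) * e t"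
      if st: "s \<in> {0..1}" "t \<in> {0..1}" for s t
    proof (cases "same s t")
      case True
      then obtain p where p: "p \<in> P" "s \<in> p" "t \<in> p" by (auto simp: same_def)
      have "slice_dist k M j s t \<le> e s + e t"
      proof (cases "p \<subseteq> U")
        case True
        then have "1 \<le> e s" using p by (auto simp: e_def)
        then show ?thesis using slice_dist_le_1[of k M j s t] by (meson add_increasing2 order.trans zero_le)
      next
        case False
        then have eq: "c j s = c j t" using c_const[OF p(1) j] p by auto
        have "c j s \<in> {0..1}" using measurable_space[OF c[OF j], of s] st by simp
        then have "slice_dist k M j s t \<le> slice_dist k M j s (c j s) + slice_dist k M j t (c j t)"
          using slice_dist_triangle[OF M j, of s t "c j s"] st eq by (simp add: slice_dist_sym[of k M j t])
        also have "\<dots> \<le> e s + e t" by (auto simp: e_def intro!: add_mono)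
        finally show ?thesis .
      qed
      then show ?thesis by (simp add: distrib_left[symmetric] mult_left_mono)
    next
      case False
      obtain p where "p \<in> P" "s \<in> p" using ex_p[OF st(1)] by blast
      then have "\<sigma> s t = 0" using False \<sigma>_eq by (auto simp: same_def)
      then show ?thesis by simp
    qed
    interpret pair_sigma_finite unit_measure unit_measure ..
    have "(\<integral>\<^sup>+s. \<integral>\<^sup>+t. ennreal (\<sigma> s t) * slice_dist k M j s t \<partial>unit_measure \<partial>unit_measure)
      \<le> (\<integral>\<^sup>+s. \<integral>\<^sup>+t. ennreal (\<sigma> s t) * e s + ennreal (\<sigma> s t) * e t \<partial>unit_measure \<partial>unit_measure)"
      using e by (intro nn_integral_mono) auto
    also have "\<dots> = (\<integral>\<^sup>+s. (\<integral>\<^sup>+t. ennreal (\<sigma> s t) * e s \<partial>unit_measure) + (\<integral>\<^sup>+t. ennreal (\<sigma> s t) * e t \<partial>unit_measure) \<partial>unit_measure)"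
      by (intro nn_integral_cong nn_integral_add) measurable
    also have "\<dots> = (\<integral>\<^sup>+s. \<integral>\<^sup>+t. ennreal (\<sigma> s t) * e s \<partial>unit_measure \<partial>unit_measure) + (\<integral>\<^sup>+s. \<integral>\<^sup>+t. ennreal (\<sigma> s t) * e t \<partial>unit_measure \<partial>unit_measure)"
      by (intro nn_integral_add) measurable
    also have "(\<integral>\<^sup>+s. \<integral>\<^sup>+t. ennreal (\<sigma> s t) * e s \<partial>unit_measure \<partial>unit_measure) = (\<integral>\<^sup>+s. e s \<partial>unit_measure)"
      by (intro nn_integral_cong) (simp add: nn_integral_multc \<sigma>1)
    also have "(\<integral>\<^sup>+s. \<integral>\<^sup>+t. ennreal (\<sigma> s t) * e t \<partial>unit_measure \<partial>unit_measure)
       = (\<integral>\<^sup>+t. \<integral>\<^sup>+s. ennreal (\<sigma> s t) * e t \<partial>unit_measure \<partial>unit_measure)"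
      by (rule Fubini'[symmetric]) measurable
    also have "\<dots> = (\<integral>\<^sup>+s. e s \<partial>unit_measure)"
      by (intro nn_integral_cong) (simp add: nn_integral_multc \<sigma>2)
    also have "(\<integral>\<^sup>+s. e s \<partial>unit_measure) = (\<integral>\<^sup>+s. slice_dist k M j s (c j s) \<partial>unit_measure) + emeasure lborel U"
    proof -
      have "U \<in> sets unit_measure" using U by (auto simp: sets_restrict_space_iff)
      moreover have "emeasure unit_measure U = emeasure lborel U" using U by (simp add: emeasure_restrict_space)
      ultimately show ?thesis unfolding e_def by (subst nn_integral_add) auto
    qed
    also have "\<dots> + \<dots> \<le> (ennreal \<theta> + ennreal u) + (ennreal \<theta> + ennreal u)"
      by (intro add_mono c_int j U)
    also have "\<dots> = ennreal (2 * (\<theta> + u))"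
      using \<theta> u by (simp flip: ennreal_plus)
    finally show ?thesis .
  qed
  \<comment> \<open>The invariant after \<open>j\<close> rounds: \<open>g\<close> depends on the
    coordinates below \<open>j\<close> through their parts only, and may still depend on the others
    in full.\<close>
  have "\<exists>g. g \<in> borel_measurable (cube k) \<and> (\<forall>w. g w \<in> {0..1}) \<and>
     (\<integral>\<^sup>+w. ennreal \<bar>g w - f w\<bar> \<partial>cube k) \<le> ennreal (real j * (2 * (\<theta> + u))) \<and>
     (\<forall>w\<in>space (cube k). \<forall>w'\<in>space (cube k).
        (\<forall>i<k. if i < j then same (w i) (w' i) else w i = w' i) \<longrightarrow> g w = g w')" if "j \<le> k" for j
    using that
  proof (induction j)
    case 0
    show ?case
    proof (intro exI[of _ f] conjI ballI impI allI)
      fix w w' assume "w \<in> space (cube k)" "w' \<in> space (cube k)"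
        "\<forall>i<k. if i < 0 then same (w i) (w' i) else w i = w' i"
      then have "w = w'" by (intro PiE_ext[of w "{..<k}" "\<lambda>_. {0..1}"]) (auto simp: space_cube)
      then show "f w = f w'" by simp
    qed (auto simp: f_def indicator_def)
  next
    case (Suc j)
    then have j: "j < k" by simp
    from Suc obtain g where g: "g \<in> borel_measurable (cube k)" "\<forall>w. g w \<in> {0..1}"
     "(\<integral>\<^sup>+w. ennreal \<bar>g w - f w\<bar> \<partial>cube k) \<le> ennreal (real j * (2 * (\<theta> + u)))"
     "\<forall>w\<in>space (cube k). \<forall>w'\<in>space (cube k).
        (\<forall>i<k. if i < j then same (w i) (w' i) else w i = w' i) \<longrightarrow> g w = g w'" by auto
    let ?A = "\<lambda>w. if w \<in> space (cube k) then \<integral>t. \<sigma> (w j) t * g (w(j := t)) \<partial>unit_measure else 0"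
    have f01: "f w \<in> {0..1}" for w by (simp add: f_def indicator_def)
    have g01: "g w \<in> {0..1}" for w using g(2) by blast
    note A = averaging_step[OF j f f01 g(1) g01 \<sigma>_meas \<sigma>_nonneg \<sigma>1 \<sigma>2]
    show ?case
    proof (intro exI[of _ ?A] conjI allI ballI impI)
      show "?A \<in> borel_measurable (cube k)" by (rule A(1))
      show "?A w \<in> {0..1}" for w by (rule A(2))
      have "(\<integral>\<^sup>+w. ennreal \<bar>?A w - f w\<bar> \<partial>cube k) \<le>
         ennreal (real j * (2 * (\<theta> + u))) + ennreal (2 * (\<theta> + u))"
        using order.trans[OF A(3) add_mono[OF g(3) slice[OF j, unfolded slice_dist_def, folded f_def]]] .
      also have "\<dots> = ennreal (real (Suc j) * (2 * (\<theta> + u)))"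
        using \<theta> u by (subst ennreal_plus[symmetric]) (auto simp: algebra_simps)
      finally show "(\<integral>\<^sup>+w. ennreal \<bar>?A w - f w\<bar> \<partial>cube k) \<le> ennreal (real (Suc j) * (2 * (\<theta> + u)))" .
    next
      fix w w' assume w: "w \<in> space (cube k)" "w' \<in> space (cube k)"
        "\<forall>i<k. if i < Suc j then same (w i) (w' i) else w i = w' i"
      obtain p where p: "p \<in> P" "w j \<in> p" "w' j \<in> p" using w(3)[rule_format, OF j] by (auto simp: same_def)
      have "(\<integral>t. \<sigma> (w j) t * g (w(j := t)) \<partial>unit_measure) = (\<integral>t. \<sigma> (w' j) t * g (w'(j := t)) \<partial>unit_measure)"
      proof (rule Bochner_Integration.integral_cong[OF refl])
        fix t assume t: "t \<in> space unit_measure"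
        have "w(j := t) \<in> space (cube k)" "w'(j := t) \<in> space (cube k)"
          using w(1,2) t j by (auto simp: space_cube PiE_iff extensional_def)
        moreover have "\<forall>i<k. if i < j then same ((w(j := t)) i) ((w'(j := t)) i) else (w(j := t)) i = (w'(j := t)) i"
          using w(3) by (auto simp: less_Suc_eq split: if_splits)
        ultimately have "g (w(j := t)) = g (w'(j := t))" using g(4) by blast
        moreover have "\<sigma> (w j) t = \<sigma> (w' j) t" using p by (simp add: \<sigma>_eq)
        ultimately show "\<sigma> (w j) t * g (w(j := t)) = \<sigma> (w' j) t * g (w'(j := t))" by simp
      qed
      then show "?A w = ?A w'" using w by simp
    qed
  qed
  from this[of k] obtain g where g: "g \<in> borel_measurable (cube k)" "\<forall>w. g w \<in> {0..1}"
     "(\<integral>\<^sup>+w. ennreal \<bar>g w - f w\<bar> \<partial>cube k) \<le> ennreal (real k * (2 * (\<theta> + u)))"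
     "\<forall>w\<in>space (cube k). \<forall>w'\<in>space (cube k). (\<forall>i<k. same (w i) (w' i)) \<longrightarrow> g w = g w'" by auto
  note [measurable] = g(1)
  define N where "N = {w \<in> space (cube k). 1 / 2 \<le> g w}"
  have N: "N \<in> sets (cube k)" unfolding N_def by measurable
  show ?thesis
  proof (intro bexI[OF _ N] conjI ballI)
    fix p x y assume p: "p \<in> {..<k} \<rightarrow>\<^sub>E P" and x: "x \<in> PiE {..<k} p" and y: "y \<in> PiE {..<k} p"
    have "PiE {..<k} p \<subseteq> space (cube k)"
      unfolding space_cube using p sub by (intro PiE_mono) (auto simp: PiE_iff)
    then have "x \<in> space (cube k)" "y \<in> space (cube k)" using x y by auto
    moreover have "\<forall>i<k. same (x i) (y i)" using x y p by (auto simp: same_def PiE_iff)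
    ultimately show "x \<in> N \<longleftrightarrow> y \<in> N" using g(4) by (auto simp: N_def)
  next
    have "(\<integral>\<^sup>+w. ennreal \<bar>indicat_real M w - indicat_real N w\<bar> \<partial>cube k) \<le> (\<integral>\<^sup>+w. 2 * ennreal \<bar>g w - f w\<bar> \<partial>cube k)"
    proof (rule nn_integral_mono)
      fix w assume w: "w \<in> space (cube k)"
      \<comment> \<open>\<open>f\<close> takes only the values 0 and 1, so a wrong rounding means
        that \<open>g\<close> is off by at least 1/2.\<close>
      have "\<bar>indicat_real M w - indicat_real N w\<bar> \<le> 2 * \<bar>g w - f w\<bar>"
        using w g(2)[rule_format, of w] by (auto simp: N_def f_def indicator_def)
      then have "ennreal \<bar>indicat_real M w - indicat_real N w\<bar> \<le> ennreal (2 * \<bar>g w - f w\<bar>)" by (rule ennreal_leI)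
      then show "ennreal \<bar>indicat_real M w - indicat_real N w\<bar> \<le> 2 * ennreal \<bar>g w - f w\<bar>"
        by (simp add: ennreal_mult)
    qed
    also have "\<dots> = 2 * (\<integral>\<^sup>+w. ennreal \<bar>g w - f w\<bar> \<partial>cube k)"
      by (rule nn_integral_cmult) measurable
    also have "\<dots> \<le> 2 * ennreal (real k * (2 * (\<theta> + u)))"
      by (rule mult_left_mono[OF g(3)]) simp
    also have "\<dots> = ennreal (2 * (real k * (2 * (\<theta> + u))))"
      using \<theta> u by (subst ennreal_mult) auto
    also have "2 * (real k * (2 * (\<theta> + u))) = 4 * real k * (\<theta> + u)" by simp
    finally show "(\<integral>\<^sup>+w. ennreal \<bar>indicat_real M w - indicat_real N w\<bar> \<partial>cube k) \<le> ennreal (4 * real k * (\<theta> + u))" .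
  qed
qed

section \<open>Traces on random samples\<close>

text \<open>Points are drawn one at a time. Fewer than \<open>N\<close> earlier points, taken as
  centres, leave a set of measure at least \<open>\<beta>\<close> uncovered, so the next point is
  far from all of them with probability at least \<open>\<beta>\<close>.\<close>

lemma separated_sample_measure:
  assumes [measurable]: "M \<in> sets (cube k)" "j < k" and "0 \<le> \<beta>"
    and cov: "\<And>C. C \<subseteq> {0..1} \<Longrightarrow> finite C \<Longrightarrow> card C < N \<Longrightarrow>
       ennreal \<beta> \<le> emeasure unit_measure {s \<in> {0..1}. \<forall>c\<in>C. a < slice_dist k M j c s}"
  shows "r \<le> N \<Longrightarrow> ennreal (\<beta> ^ r) \<le>
     emeasure (cube r) {x \<in> space (cube r). \<forall>i<r. \<forall>i'<i. a < slice_dist k M j (x i') (x i)}"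
proof (induction r)
  case 0
  show ?case by (simp add: cube_k.emeasure_space_1)
next
  case (Suc r)
  define S where "S r = {x \<in> space (cube r). \<forall>i<r. \<forall>i'<i. a < slice_dist k M j (x i') (x i)}" for r
  have meas: "S r \<in> sets (cube r)" for r unfolding S_def by measurable
  have ind_meas: "indicator (S (Suc r)) \<in> borel_measurable (PiM (insert r {..<r}) (\<lambda>_. unit_measure))"
    using borel_measurable_indicator[OF meas[of "Suc r"]] by (simp only: cube_def lessThan_Suc)
  have "emeasure (cube (Suc r)) (S (Suc r)) = (\<integral>\<^sup>+z. indicator (S (Suc r)) z \<partial>cube (Suc r))"
    using meas by simp
  also have "\<dots> = (\<integral>\<^sup>+x. \<integral>\<^sup>+s. indicator (S (Suc r)) (x(r := s)) \<partial>unit_measure \<partial>cube r)"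
    unfolding cube_def[of "Suc r"] cube_def[of r] lessThan_Suc
    by (rule cube.product_nn_integral_insert) (use ind_meas in simp_all)
  also have "\<dots> \<ge> (\<integral>\<^sup>+x. ennreal \<beta> * indicator (S r) x \<partial>cube r)"
  proof (rule nn_integral_mono)
    fix x assume x: "x \<in> space (cube r)"
    show "ennreal \<beta> * indicator (S r) x \<le> (\<integral>\<^sup>+s. indicator (S (Suc r)) (x(r := s)) \<partial>unit_measure)"
    proof (cases "x \<in> S r")
      case True
      let ?C = "x ` {..<r}"
      let ?B = "{s \<in> {0..1}. \<forall>c\<in>?C. a < slice_dist k M j c s}"
      have C: "?C \<subseteq> {0..1}" using x by (auto simp: space_cube PiE_iff)
      then have cm: "c \<in> space unit_measure" if "c \<in> ?C" for c using that by auto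
      have "?B = {s \<in> space unit_measure. \<forall>c\<in>?C. a < slice_dist k M j c s}" by simp
      also have "\<dots> \<in> sets unit_measure"
      proof (rule sets.sets_Collect_finite_All)
        fix c assume "c \<in> ?C"
        note [measurable] = cm[OF this]
        show "{s \<in> space unit_measure. a < slice_dist k M j c s} \<in> sets unit_measure" by measurable
      qed simp
      finally have B: "?B \<in> sets unit_measure" .
      have "card ?C < N" using card_image_le[of "{..<r}" x] Suc.prems by simp
      then have "ennreal \<beta> \<le> emeasure unit_measure ?B" using C by (intro cov) auto
      also have "\<dots> = (\<integral>\<^sup>+s. indicator ?B s \<partial>unit_measure)" using B by simp
      also have "\<dots> \<le> (\<integral>\<^sup>+s. indicator (S (Suc r)) (x(r := s)) \<partial>unit_measure)"
      proof (rule nn_integral_mono)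
        fix s assume s: "s \<in> space unit_measure"
        have "x(r := s) \<in> S (Suc r)" if "s \<in> ?B"
        proof -
          have "x(r := s) \<in> space (cube (Suc r))"
            using x s by (auto simp: space_cube PiE_iff extensional_def)
          moreover have "a < slice_dist k M j ((x(r := s)) i') ((x(r := s)) i)" if "i < Suc r" "i' < i" for i i'
            using that \<open>s \<in> ?B\<close> True by (cases "i = r") (auto simp: S_def)
          ultimately show ?thesis by (auto simp: S_def)
        qed
        then show "indicator ?B s \<le> (indicator (S (Suc r)) (x(r := s)) :: ennreal)"
          by (cases "s \<in> ?B") (auto simp: indicator_def)
      qed
      finally show ?thesis using True by simp
    qed simp
  qed
  also have "(\<integral>\<^sup>+x. ennreal \<beta> * indicator (S r) x \<partial>cube r) = ennreal \<beta> * emeasure (cube r) (S r)"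
    using meas by (intro nn_integral_cmult_indicator)
  finally have "ennreal \<beta> * emeasure (cube r) (S r) \<le> emeasure (cube (Suc r)) (S (Suc r))" .
  moreover have "ennreal (\<beta> ^ Suc r) \<le> ennreal \<beta> * emeasure (cube r) (S r)"
    using Suc.IH[folded S_def] Suc.prems \<open>0 \<le> \<beta>\<close> by (simp add: ennreal_mult mult_left_mono)
  ultimately show ?case unfolding S_def[symmetric] by (rule order.trans[rotated])
qed

text \<open>A sample in \<open>cube (N + s * k)\<close> is read as \<open>N\<close> single points
  followed by \<open>s\<close> blocks of length \<open>k\<close>. A block keeps an entry at place
  \<open>j\<close>, later overwritten by a single point, so that it is itself an element of
  \<open>cube k\<close>.\<close>

definition block :: "nat \<Rightarrow> nat \<Rightarrow> nat \<Rightarrow> (nat \<Rightarrow> real) \<Rightarrow> nat \<Rightarrow> real" where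
  "block k N l z = (\<lambda>c\<in>{..<k}. z (N + l * k + c))"

lemma block_index_less:
  assumes "l < s" "c < k"
  shows "l * k + c < s * (k::nat)"
proof -
  have "l * k + c < Suc l * k" using assms by simp
  also have "\<dots> \<le> s * k" using assms by (intro mult_le_mono1) simp
  finally show ?thesis .
qed

lemma measurable_block [measurable]:
  assumes "\<And>c. c < k \<Longrightarrow> N + l * k + c \<in> I"
  shows "block k N l \<in> measurable (PiM I (\<lambda>_. unit_measure)) (cube k)"
  unfolding block_def[abs_def] cube_def
  by (rule measurable_restrict) (use assms in \<open>auto intro!: measurable_component_singleton\<close>)

lemma emeasure_block:
  assumes A: "A \<in> sets (cube k)"
  shows "emeasure (PiM {N + l * k..<N + l * k + k} (\<lambda>_. unit_measure))
    {z \<in> space (PiM {N + l * k..<N + l * k + k} (\<lambda>_. unit_measure)). block k N l z \<in> A} = emeasure (cube k) A"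
proof -
  let ?I = "{N + l * k..<N + l * k + k}"
  have d: "distr (PiM ?I (\<lambda>_. unit_measure)) (cube k) (block k N l) = cube k"
    unfolding cube_def block_def[abs_def]
    by (rule distr_PiM_reindex) (auto intro!: prob_space_unit inj_onI)
  have "emeasure (cube k) A = emeasure (distr (PiM ?I (\<lambda>_. unit_measure)) (cube k) (block k N l)) A"
    by (simp add: d)
  also have "\<dots> = emeasure (PiM ?I (\<lambda>_. unit_measure)) (block k N l -` A \<inter> space (PiM ?I (\<lambda>_. unit_measure)))"
    using A by (intro emeasure_distr measurable_block) auto
  finally show ?thesis by (simp add: vimage_def Int_def conj_commute)
qed

text \<open>The blocks occupy disjoint index intervals and hence are independent; the induction
  splits off the last interval by Fubini.\<close>

lemma emeasure_blocks:
  assumes A: "A \<in> sets (cube k)"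
  shows "emeasure (PiM {N..<N + s * k} (\<lambda>_. unit_measure))
    {z \<in> space (PiM {N..<N + s * k} (\<lambda>_. unit_measure)). \<forall>l<s. block k N l z \<in> A} = emeasure (cube k) A ^ s"
proof (induction s)
  case 0
  show ?case by (simp add: PiM_empty)
next
  case (Suc s)
  define P where "P I = (PiM I (\<lambda>_. unit_measure) :: (nat \<Rightarrow> real) measure)" for I
  define B where "B I L = {z \<in> space (P I). \<forall>l\<in>L. block k N l z \<in> A}" for I L
  let ?I = "{N..<N + s * k}" and ?J = "{N + s * k..<N + s * k + k}"
  have un: "{N..<N + Suc s * k} = ?I \<union> ?J" by auto
  have disj: "?I \<inter> ?J = {}" by auto
  have meas: "B I L \<in> sets (P I)" if "finite L" "\<And>l c. l \<in> L \<Longrightarrow> c < k \<Longrightarrow> N + l * k + c \<in> I" for I L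
    unfolding B_def
  proof (rule sets.sets_Collect_finite_All[OF _ that(1)])
    fix l assume "l \<in> L"
    then have "block k N l -` A \<inter> space (P I) \<in> sets (P I)"
      using A that(2) unfolding P_def by (intro measurable_sets[OF measurable_block]) auto
    then show "{z \<in> space (P I). block k N l z \<in> A} \<in> sets (P I)"
      by (simp add: vimage_def Int_def conj_commute)
  qed
  have idx: "N + l * k + c \<in> ?I" if "l < s" "c < k" for l c
    using block_index_less[OF that] by simp
  have idx': "N + l * k + c \<in> ?I \<union> ?J" if "l < Suc s" "c < k" for l c
    using block_index_less[OF that] by auto
  have mI: "B ?I {..<s} \<in> sets (P ?I)" by (rule meas) (use idx in auto)
  have mIJ: "B (?I \<union> ?J) {..<Suc s} \<in> sets (P (?I \<union> ?J))"
    by (rule meas) (use idx' in auto)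
  have mJ: "B ?J {s} \<in> sets (P ?J)" by (rule meas) auto
  have merge_ind: "indicator (B (?I \<union> ?J) {..<Suc s}) (merge ?I ?J (x, y)) =
      (indicator (B ?I {..<s}) x * indicator (B ?J {s}) y :: ennreal)"
    if x: "x \<in> space (P ?I)" and y: "y \<in> space (P ?J)" for x y
  proof -
    have "merge ?I ?J (x, y) \<in> space (P (?I \<union> ?J))"
      using x y by (auto simp: P_def space_PiM)
    moreover have "block k N l (merge ?I ?J (x, y)) = block k N l x" if "l < s" for l
      unfolding block_def using idx[OF that] by (intro restrict_ext) (simp add: merge_def)
    moreover have "block k N s (merge ?I ?J (x, y)) = block k N s y"
      unfolding block_def by (intro restrict_ext) (simp add: merge_def)
    ultimately have "merge ?I ?J (x, y) \<in> B (?I \<union> ?J) {..<Suc s} \<longleftrightarrow> x \<in> B ?I {..<s} \<and> y \<in> B ?J {s}"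
      using x y unfolding B_def by (auto simp: lessThan_Suc)
    then show ?thesis by (auto simp: indicator_def)
  qed
  have "emeasure (P (?I \<union> ?J)) (B (?I \<union> ?J) {..<Suc s}) =
      (\<integral>\<^sup>+z. indicator (B (?I \<union> ?J) {..<Suc s}) z \<partial>P (?I \<union> ?J))"
    using mIJ by simp
  also have "\<dots> = (\<integral>\<^sup>+x. \<integral>\<^sup>+y. indicator (B (?I \<union> ?J) {..<Suc s}) (merge ?I ?J (x, y)) \<partial>P ?J \<partial>P ?I)"
    unfolding P_def
    by (rule cube.product_nn_integral_fold[OF disj])
       (use borel_measurable_indicator[OF mIJ] in \<open>simp_all add: P_def\<close>)
  also have "\<dots> = (\<integral>\<^sup>+x. \<integral>\<^sup>+y. indicator (B ?I {..<s}) x * indicator (B ?J {s}) y \<partial>P ?J \<partial>P ?I)"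
    using merge_ind by (intro nn_integral_cong) simp
  also have "\<dots> = (\<integral>\<^sup>+x. indicator (B ?I {..<s}) x * emeasure (P ?J) (B ?J {s}) \<partial>P ?I)"
    using mJ by (intro nn_integral_cong) (simp add: nn_integral_cmult)
  also have "\<dots> = emeasure (P ?I) (B ?I {..<s}) * emeasure (P ?J) (B ?J {s})"
    using mI by (simp add: nn_integral_multc)
  also have "emeasure (P ?J) (B ?J {s}) = emeasure (cube k) A"
    using emeasure_block[OF A, of N s] by (simp add: P_def B_def)
  also have "emeasure (P ?I) (B ?I {..<s}) = emeasure (cube k) A ^ s"
    using Suc.IH unfolding P_def B_def Ball_def lessThan_iff .
  finally show ?case unfolding un P_def B_def Ball_def lessThan_iff by (simp only: power_Suc mult.commute)
qed

text \<open>The slice at the point \<open>z i\<close>, as seen by the \<open>s\<close> blocks.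
  Recording block numbers instead of tuples makes \<open>{..<s}\<close> the ground set for Sauer's
  bound.\<close>

definition sample_trace :: "nat \<Rightarrow> (nat \<Rightarrow> real) set \<Rightarrow> nat \<Rightarrow> nat \<Rightarrow> nat \<Rightarrow> (nat \<Rightarrow> real) \<Rightarrow> nat \<Rightarrow> nat set" where
  "sample_trace k M j N s z i = {l. l < s \<and> (block k N l z)(j := z i) \<in> M}"

text \<open>The single points are pairwise more than \<open>a\<close> apart with probability at
  least \<open>\<beta> ^ N\<close>. Given that, one block fails to distinguish a fixed pair with
  probability at most \<open>1 - a\<close>, all \<open>s\<close> independent blocks fail with
  probability at most \<open>(1 - a) ^ s\<close>, and the union bound over at most
  \<open>N ^ 2\<close> pairs leaves probability at least 1/2.\<close>

lemma distinct_traces_measure: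
  assumes M: "M \<in> sets (cube k)" and j: "j < k" and a: "0 \<le> a" "a \<le> 1" and "0 \<le> \<beta>"
    and s: "real N ^ 2 * (1 - a) ^ s \<le> 1 / 2"
    and cov: "\<And>C. C \<subseteq> {0..1} \<Longrightarrow> finite C \<Longrightarrow> card C < N \<Longrightarrow>
       ennreal \<beta> \<le> emeasure unit_measure {t \<in> {0..1}. \<forall>c\<in>C. ennreal a < slice_dist k M j c t}"
  defines "G \<equiv> {z \<in> space (cube (N + s * k)). inj_on (sample_trace k M j N s z) {..<N}}"
  shows "G \<in> sets (cube (N + s * k))" and "\<beta> ^ N / 2 \<le> measure (cube (N + s * k)) G"
proof -
  define P where "P I = (PiM I (\<lambda>_. unit_measure) :: (nat \<Rightarrow> real) measure)" for I
  let ?I = "{..<N}" and ?J = "{N..<N + s * k}"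
  let ?n = "N + s * k"
  have un: "{..<?n} = ?I \<union> ?J" by auto
  have disj: "?I \<inter> ?J = {}" by auto
  have cP: "cube ?n = P (?I \<union> ?J)" "cube N = P ?I" unfolding un[symmetric] by (simp_all add: cube_def P_def)
  have idx: "N + l * k + c \<in> ?J" if "l < s" "c < k" for l c
    using block_index_less[OF that] by simp
  \<comment> \<open>The event that some block tells point \<open>i\<close> from point
    \<open>i'\<close>. Writing \<open>G\<close> as a finite combination of such events yields its
    measurability.\<close>
  define D where "D i i' = {z \<in> space (cube ?n). \<exists>l\<in>{..<s}.
      ((block k N l z)(j := z i) \<in> M) \<noteq> ((block k N l z)(j := z i') \<in> M)}" for i i'
  have Dm: "D i i' \<in> sets (cube ?n)" if "i < N" "i' < N" for i i'
    unfolding D_def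
  proof (rule sets.sets_Collect_finite_Ex)
    fix l assume "l \<in> {..<s}"
    then have [measurable]: "block k N l \<in> measurable (cube ?n) (cube k)"
      unfolding cP P_def using idx by (intro measurable_block) auto
    note [measurable] = M j
    have [measurable]: "i < ?n" "i' < ?n" using that by auto
    show "{z \<in> space (cube ?n). ((block k N l z)(j := z i) \<in> M) \<noteq> ((block k N l z)(j := z i') \<in> M)} \<in> sets (cube ?n)"
      by measurable
  qed simp
  have trace_iff: "sample_trace k M j N s z i \<noteq> sample_trace k M j N s z i' \<longleftrightarrow> z \<in> D i i'"
    if "z \<in> space (cube ?n)" for z i i'
    using that unfolding D_def sample_trace_def by auto
  have "G = {z \<in> space (cube ?n). \<forall>i\<in>{..<N}. \<forall>i'\<in>{..<i}. z \<in> D i i'}"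
  proof (intro set_eqI iffI)
    fix z assume "z \<in> G"
    then have z: "z \<in> space (cube ?n)" and inj: "inj_on (sample_trace k M j N s z) {..<N}" by (auto simp: G_def)
    have "z \<in> D i i'" if "i < N" "i' < i" for i i'
      using inj_onD[OF inj, of i i'] that trace_iff[OF z, of i i'] by auto
    with z show "z \<in> {z \<in> space (cube ?n). \<forall>i\<in>{..<N}. \<forall>i'\<in>{..<i}. z \<in> D i i'}" by blast
  next
    fix z assume z: "z \<in> {z \<in> space (cube ?n). \<forall>i\<in>{..<N}. \<forall>i'\<in>{..<i}. z \<in> D i i'}"
    have "sample_trace k M j N s z i \<noteq> sample_trace k M j N s z i'" if "i < N" "i' < i" for i i'
      using z that trace_iff[of z i i'] by blast
    then have "inj_on (sample_trace k M j N s z) {..<N}"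
      by (intro inj_onI) (metis lessThan_iff linorder_neqE_nat)
    then show "z \<in> G" using z by (simp add: G_def)
  qed
  note G_eq = this
  show Gm: "G \<in> sets (cube ?n)"
    unfolding G_eq
  proof (intro sets.sets_Collect_finite_All)
    fix i i' assume "i \<in> {..<N}" "i' \<in> {..<i}"
    then have "space (cube ?n) \<inter> D i i' \<in> sets (cube ?n)" by (intro sets.Int Dm sets.top) auto
    then show "{z \<in> space (cube ?n). z \<in> D i i'} \<in> sets (cube ?n)" by (simp add: Int_def)
  qed simp_all
  define S where "S = {x \<in> space (cube N). \<forall>i<N. \<forall>i'<i. ennreal a < slice_dist k M j (x i') (x i)}"
  have S: "S \<in> sets (cube N)" unfolding S_def using M j by measurable
  have ind_meas: "indicator G \<in> borel_measurable (P (?I \<union> ?J))"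
    using borel_measurable_indicator[OF Gm] by (simp only: cP)
  have inner: "ennreal (1 / 2) * indicator S x \<le> (\<integral>\<^sup>+y. indicator G (merge ?I ?J (x, y)) \<partial>P ?J)"
    if x: "x \<in> space (P ?I)" for x
  proof (cases "x \<in> S")
    case True
    interpret PJ: prob_space "P ?J" unfolding P_def by (intro prob_space_PiM prob_space_unit)
    define H where "H = {y \<in> space (P ?J). merge ?I ?J (x, y) \<in> G}"
    have mm: "merge ?I ?J (x, y) \<in> space (cube ?n)" if "y \<in> space (P ?J)" for y
      using x that unfolding cP by (simp add: P_def space_PiM PiE_iff) (auto simp: merge_def)
    have xI: "x i \<in> space unit_measure" if "i < N" for i using x that by (auto simp: P_def space_PiM PiE_iff)
    have "(\<lambda>y. merge ?I ?J (x, y)) \<in> measurable (P ?J) (P (?I \<union> ?J))"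
      unfolding P_def using x by (intro measurable_compose[OF measurable_Pair1' measurable_merge]) (simp add: P_def)
    then have Hm: "H \<in> sets (P ?J)"
      using measurable_sets[of _ "P ?J" "P (?I \<union> ?J)" G] Gm unfolding cP H_def
      by (simp add: vimage_def Int_def conj_commute)
    define A where "A i i' = {w \<in> space (cube k). (w(j := x i) \<in> M) = (w(j := x i') \<in> M)}" for i i'
    define Bad where "Bad i i' = {y \<in> space (P ?J). \<forall>l<s. block k N l y \<in> A i i'}" for i i'
    have Am: "A i i' \<in> sets (cube k)" if "i < N" "i' < N" for i i'
    proof -
      note [measurable] = xI[OF that(1)] xI[OF that(2)] M j
      show ?thesis unfolding A_def by measurable
    qed
    have A_le: "measure (cube k) (A i i') \<le> 1 - a" if "i < N" "i' < i" for i i'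
    proof -
      have i': "i' < N" using that by simp
      let ?E = "space (cube k) - A i i'"
      have "ennreal a < slice_dist k M j (x i') (x i)" using True that unfolding S_def by blast
      \<comment> \<open>The integrand is 1 exactly where the two slices disagree, so the slice
        distance is the probability that a random block separates the points.\<close>
      also have "slice_dist k M j (x i') (x i) = (\<integral>\<^sup>+w. indicator ?E w \<partial>cube k)"
        unfolding slice_dist_def by (intro nn_integral_cong) (auto simp: A_def indicator_def)
      also have "\<dots> = emeasure (cube k) ?E" using Am[OF that(1) i'] by simp
      also have "\<dots> = ennreal (measure (cube k) ?E)" by (rule cube_k.emeasure_eq_measure)
      finally have "a < measure (cube k) ?E" using a by (simp add: ennreal_less_iff)
      then show ?thesis using cube_k.prob_compl[OF Am[OF that(1) i']] by simp
    qed
    have Badm: "Bad i i' \<in> sets (P ?J)" if "i < N" "i' < N" for i i'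
    proof -
      have "Bad i i' = {y \<in> space (P ?J). \<forall>l\<in>{..<s}. block k N l y \<in> A i i'}" by (auto simp: Bad_def)
      also have "\<dots> \<in> sets (P ?J)"
      proof (rule sets.sets_Collect_finite_All)
        fix l assume "l \<in> {..<s}"
        then have "block k N l -` A i i' \<inter> space (P ?J) \<in> sets (P ?J)"
          using Am[OF that] idx unfolding P_def by (intro measurable_sets[OF measurable_block]) auto
        then show "{y \<in> space (P ?J). block k N l y \<in> A i i'} \<in> sets (P ?J)"
          by (simp add: vimage_def Int_def conj_commute)
      qed simp
      finally show ?thesis .
    qed
    have Bad_le: "measure (P ?J) (Bad i i') \<le> (1 - a) ^ s" if "i < N" "i' < i" for i i'
    proof -
      have "emeasure (P ?J) (Bad i i') = emeasure (cube k) (A i i') ^ s"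
        unfolding Bad_def P_def by (rule emeasure_blocks) (use that in \<open>auto intro!: Am\<close>)
      then have "measure (P ?J) (Bad i i') = measure (cube k) (A i i') ^ s"
        by (simp add: PJ.emeasure_eq_measure cube_k.emeasure_eq_measure ennreal_power)
      also have "\<dots> \<le> (1 - a) ^ s" by (rule power_mono[OF A_le[OF that]]) simp
      finally show ?thesis .
    qed
    have sub: "space (P ?J) - H \<subseteq> (\<Union>i<N. \<Union>i'<i. Bad i i')"
    proof
      fix y assume y: "y \<in> space (P ?J) - H"
      let ?z = "merge ?I ?J (x, y)"
      have zs: "?z \<in> space (cube ?n)" using mm y by blast
      then obtain i i' where i: "i < N" "i' < i" "?z \<notin> D i i'"
        using y unfolding H_def G_eq by blast
      have "block k N l ?z = block k N l y" if "l < s" for l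
        unfolding block_def using idx[OF that] by (intro restrict_ext) (simp add: merge_def)
      moreover have "?z i = x i" "?z i' = x i'" using i by (simp_all add: merge_def)
      moreover have "block k N l y \<in> space (cube k)" if "l < s" for l
        using y idx[OF that] by (auto simp: block_def space_cube P_def space_PiM PiE_iff)
      ultimately have "block k N l y \<in> A i i'" if "l < s" for l
        using i(3) zs that unfolding D_def A_def by auto
      then have "y \<in> Bad i i'" using y unfolding Bad_def by blast
      then show "y \<in> (\<Union>i<N. \<Union>i'<i. Bad i i')" using i by blast
    qed
    have "measure (P ?J) (space (P ?J) - H) \<le> measure (P ?J) (\<Union>i<N. \<Union>i'<i. Bad i i')"
      using Badm by (intro PJ.finite_measure_mono sub sets.finite_UN) auto
    also have "\<dots> \<le> (\<Sum>i<N. measure (P ?J) (\<Union>i'<i. Bad i i'))"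
      using Badm by (intro measure_UNION_le sets.finite_UN) auto
    also have "\<dots> \<le> (\<Sum>i<N. \<Sum>i'<i. measure (P ?J) (Bad i i'))"
      using Badm by (intro sum_mono measure_UNION_le) auto
    also have "\<dots> \<le> (\<Sum>i<N. \<Sum>i'<i. (1 - a) ^ s)"
      using Bad_le by (intro sum_mono) auto
    also have "\<dots> = (\<Sum>i<N. real i * (1 - a) ^ s)" by simp
    also have "\<dots> \<le> (\<Sum>i<N. real N * (1 - a) ^ s)"
      using a by (intro sum_mono mult_right_mono) auto
    also have "\<dots> = real N ^ 2 * (1 - a) ^ s" by (simp add: power2_eq_square)
    also have "\<dots> \<le> 1 / 2" by (rule s)
    finally have "1 / 2 \<le> measure (P ?J) H" using PJ.prob_compl[OF Hm] by simp
    then have "ennreal (1 / 2) \<le> emeasure (P ?J) H" unfolding PJ.emeasure_eq_measure by (rule ennreal_leI)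
    also have "\<dots> = (\<integral>\<^sup>+y. indicator H y \<partial>P ?J)" using Hm by simp
    also have "\<dots> = (\<integral>\<^sup>+y. indicator G (merge ?I ?J (x, y)) \<partial>P ?J)"
      by (intro nn_integral_cong) (auto simp: H_def indicator_def)
    finally show ?thesis using True by simp
  qed simp
  have "ennreal (\<beta> ^ N) \<le> emeasure (cube N) S"
    unfolding S_def by (rule separated_sample_measure[OF M j \<open>0 \<le> \<beta>\<close> _ order_refl]) (rule cov)
  then have "ennreal (1 / 2) * ennreal (\<beta> ^ N) \<le> ennreal (1 / 2) * emeasure (cube N) S"
    by (rule mult_left_mono) simp
  moreover have "ennreal (\<beta> ^ N / 2) = ennreal (1 / 2) * ennreal (\<beta> ^ N)"
    using \<open>0 \<le> \<beta>\<close> by (subst ennreal_mult[symmetric]) auto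
  ultimately have "ennreal (\<beta> ^ N / 2) \<le> ennreal (1 / 2) * emeasure (cube N) S" by simp
  also have "\<dots> = (\<integral>\<^sup>+x. ennreal (1 / 2) * indicator S x \<partial>P ?I)"
    using S unfolding cP by (rule nn_integral_cmult_indicator[symmetric])
  also have "\<dots> \<le> (\<integral>\<^sup>+x. \<integral>\<^sup>+y. indicator G (merge ?I ?J (x, y)) \<partial>P ?J \<partial>P ?I)"
    by (intro nn_integral_mono inner)
  also have "\<dots> = (\<integral>\<^sup>+z. indicator G z \<partial>P (?I \<union> ?J))"
    unfolding P_def
    by (rule cube.product_nn_integral_fold[OF disj, symmetric]) (use ind_meas in \<open>simp_all add: P_def\<close>)
  also have "\<dots> = emeasure (cube ?n) G" using Gm unfolding cP by simp
  also have "\<dots> = ennreal (measure (cube ?n) G)" by (rule cube_k.emeasure_eq_measure)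
  finally show "\<beta> ^ N / 2 \<le> measure (cube ?n) G" by (simp add: ennreal_le_iff)
qed

section \<open>Branching in sampled structures\<close>

text \<open>For a sample \<open>z\<close> of reals this is the structure induced on the sample
  indices; for an injection \<open>e\<close> of indices it is a relabelled substructure.\<close>

definition pullback :: "('l \<Rightarrow> nat) \<Rightarrow> ('a \<Rightarrow> 'b) \<Rightarrow> 'a set \<Rightarrow> ('l \<Rightarrow> (nat \<Rightarrow> 'b) set) \<Rightarrow> 'l \<Rightarrow> (nat \<Rightarrow> 'a) set" where
  "pullback ar h A R = (\<lambda>E. {v \<in> {..<ar E} \<rightarrow>\<^sub>E A. compose {..<ar E} h v \<in> R E})"

lemma compose_in_PiE: "v \<in> I \<rightarrow>\<^sub>E A \<Longrightarrow> h \<in> A \<rightarrow> B \<Longrightarrow> compose I h v \<in> I \<rightarrow>\<^sub>E B"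
  by (auto simp: compose_def PiE_iff)

text \<open>A tree only records whether \<open>E\<close> holds of merged tuples, and merging
  commutes with composition, so the witnesses can be composed with \<open>h\<close>.\<close>

lemma has_branching_transfer:
  fixes ar :: "'l \<Rightarrow> nat"
  assumes j: "j < ar E" and h: "h \<in> A \<rightarrow> B"
    and iff: "\<And>v. v \<in> {..<ar E} \<rightarrow>\<^sub>E A \<Longrightarrow> v \<in> R E \<longleftrightarrow> compose {..<ar E} h v \<in> S E"
    and br: "has_branching (\<lambda>R v. v \<in> R E) {j} ({..<ar E} - {j}) \<tau> A R"
  shows "has_branching (\<lambda>R v. v \<in> R E) {j} ({..<ar E} - {j}) \<tau> B S"
proof -
  let ?Y = "{..<ar E} - {j}"
  obtain a b where ab: "\<And>i. length i = \<tau> \<Longrightarrow> a i \<in> {j} \<rightarrow>\<^sub>E A" "\<And>l. length l < \<tau> \<Longrightarrow> b l \<in> ?Y \<rightarrow>\<^sub>E A"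
    "\<And>i l h. length i = \<tau> \<Longrightarrow> length l < \<tau> \<Longrightarrow> prefix (l @ [h]) i \<Longrightarrow> (merge {j} ?Y (a i, b l) \<in> R E \<longleftrightarrow> h)"
    using br unfolding has_branching_def by blast
  have c: "merge {j} ?Y (compose {j} h (a i), compose ?Y h (b l)) \<in> S E \<longleftrightarrow> r"
    if "length i = \<tau>" "length l < \<tau>" "prefix (l @ [r]) i" for i l r
  proof -
    have "merge {j} ?Y (a i, b l) \<in> {..<ar E} \<rightarrow>\<^sub>E A"
      using ab(1)[OF that(1)] ab(2)[OF that(2)] j by (auto simp: PiE_iff merge_def extensional_def)
    moreover have "merge {j} ?Y (compose {j} h (a i), compose ?Y h (b l)) = compose {..<ar E} h (merge {j} ?Y (a i, b l))"
      using j by (auto simp: merge_def compose_def)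
    ultimately show ?thesis using iff ab(3)[OF that] by simp
  qed
  show ?thesis unfolding has_branching_def
  proof (rule exI[of _ "\<lambda>i. compose {j} h (a i)"], rule exI[of _ "\<lambda>l. compose ?Y h (b l)"],
      intro conjI allI impI)
    show "compose {j} h (a i) \<in> {j} \<rightarrow>\<^sub>E B" if "length i = \<tau>" for i
      by (rule compose_in_PiE[OF ab(1)[OF that] h])
    show "compose ?Y h (b l) \<in> ?Y \<rightarrow>\<^sub>E B" if "length l < \<tau>" for l
      by (rule compose_in_PiE[OF ab(2)[OF that] h])
  qed (rule c)
qed

text \<open>An inclusion-minimal branching subset of \<open>A\<close> exists by finiteness, and
  \<open>e\<close> enumerates it because \<open>borel_branching\<close> asks for an initial segment
  as underlying set. Branching on a proper subset of the indices would be pushed forward by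
  \<open>e\<close> to a proper subset of the minimal one.\<close>

lemma exists_minimal_branching:
  fixes ar :: "'l \<Rightarrow> nat" and R :: "'l \<Rightarrow> (nat \<Rightarrow> 'a) set"
  assumes j: "j < ar E" and "finite A" and R: "is_structure ar A R"
    and br: "has_branching (\<lambda>R v. v \<in> R E) {j} ({..<ar E} - {j}) \<tau> A R"
  shows "\<exists>(k::nat) e. inj_on e {..<k} \<and> e ` {..<k} \<subseteq> A \<and>
    minimally_has_branching ar (\<lambda>R v. v \<in> R E) {j} ({..<ar E} - {j}) \<tau> {..<k} (pullback ar e {..<k} R)"
proof -
  let ?br = "has_branching (\<lambda>R v. v \<in> R E) {j} ({..<ar E} - {j}) \<tau>"
  have "induced ar R A = R" using R by (auto simp: induced_def is_structure_def)
  define \<B> where "\<B> = {B. B \<subseteq> A \<and> ?br B (induced ar R B)}"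
  have "A \<in> \<B>" using br \<open>induced ar R A = R\<close> by (simp add: \<B>_def)
  moreover have "finite \<B>" using \<open>finite A\<close> by (simp add: \<B>_def)
  ultimately obtain B where "B \<in> \<B>" and Bmin: "\<forall>C\<in>\<B>. C \<le> B \<longrightarrow> B = C"
    using finite_has_minimal[of \<B>] by blast
  then have B: "B \<subseteq> A" "?br B (induced ar R B)" by (simp_all add: \<B>_def)
  have min: "C = B" if "C \<subseteq> A" "?br C (induced ar R C)" "C \<subseteq> B" for C
    using Bmin that by (auto simp: \<B>_def)
  have "finite B" using B(1) \<open>finite A\<close> finite_subset by blast
  then obtain e where e: "bij_betw e {..<card B} B"
    using ex_bij_betw_nat_finite[of B] by (auto simp: atLeast0LessThan)
  let ?k = "card B" and ?F = "pullback ar e {..<card B} R"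
  have img: "e ` {..<?k} = B" and inj: "inj_on e {..<?k}" using e by (auto simp: bij_betw_def)
  have "?br {..<?k} ?F"
  proof (rule has_branching_transfer[where h = "the_inv_into {..<?k} e" and ar = ar and E = E, OF j _ _ B(2)])
    show "the_inv_into {..<?k} e \<in> B \<rightarrow> {..<?k}"
      using img the_inv_into_into[OF inj, of _ "{..<?k}"] by blast
    fix v assume v: "v \<in> {..<ar E} \<rightarrow>\<^sub>E B"
    have "compose {..<ar E} e (compose {..<ar E} (the_inv_into {..<?k} e) v) = v"
      using v img f_the_inv_into_f[OF inj]
      by (intro PiE_ext[of _ "{..<ar E}" "\<lambda>_. B"]) (auto simp: compose_def PiE_iff)
    moreover have "compose {..<ar E} (the_inv_into {..<?k} e) v \<in> {..<ar E} \<rightarrow>\<^sub>E {..<?k}"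
      by (rule compose_in_PiE[OF v]) (use img the_inv_into_into[OF inj, of _ "{..<?k}"] in blast)
    ultimately show "v \<in> induced ar R B E \<longleftrightarrow> compose {..<ar E} (the_inv_into {..<?k} e) v \<in> ?F E"
      using v by (simp add: induced_def pullback_def)
  qed
  moreover have "\<not> ?br C (induced ar ?F C)" if C: "C \<subset> {..<?k}" for C
  proof
    assume br: "?br C (induced ar ?F C)"
    have eC: "e ` C \<subset> B" using image_strict_mono[OF inj C] img by simp
    have "?br (e ` C) (induced ar R (e ` C))"
    proof (rule has_branching_transfer[where h = e and ar = ar and E = E, OF j _ _ br])
      fix v assume v: "v \<in> {..<ar E} \<rightarrow>\<^sub>E C"
      then have "v \<in> {..<ar E} \<rightarrow>\<^sub>E {..<?k}" using C by (auto simp: PiE_iff)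
      moreover have "compose {..<ar E} e v \<in> {..<ar E} \<rightarrow>\<^sub>E e ` C" by (rule compose_in_PiE[OF v]) auto
      ultimately show "v \<in> induced ar ?F C E \<longleftrightarrow> compose {..<ar E} e v \<in> induced ar R (e ` C) E"
        using v by (simp add: induced_def pullback_def)
    qed auto
    then have "e ` C = B" using min[of "e ` C"] eC B(1) by blast
    then show False using eC by blast
  qed
  ultimately show ?thesis using inj img B(1) unfolding minimally_has_branching_def by blast
qed

text \<open>Sauer's bound gives a tree of traces. Its leaves come from single sample points and its
  inner nodes are block numbers, so it can be read as a tree of tuples of sample indices.\<close>

lemma has_branching_of_distinct_traces:
  assumes j: "j < ar E" and z: "z \<in> space (cube (N + s * ar E))" and N: "(s + 1) ^ (\<tau> - 1) < N"
    and inj: "inj_on (sample_trace (ar E) (M E) j N s z) {..<N}"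
  shows "has_branching (\<lambda>R v. v \<in> R E) {j} ({..<ar E} - {j}) \<tau> {..<N + s * ar E} (pullback ar z {..<N + s * ar E} M)"
proof -
  let ?k = "ar E" and ?Y = "{..<ar E} - {j}"
  let ?T = "sample_trace ?k (M E) j N s z"
  have "card (?T ` {..<N}) = N" using inj by (simp add: card_image)
  then have "set_branching \<tau> (?T ` {..<N}) {..<s}"
    using N by (intro set_branching_of_card) (auto simp: sample_trace_def)
  then obtain a b where ab: "\<And>i. length i = \<tau> \<Longrightarrow> a i \<in> ?T ` {..<N}" "\<And>l. length l < \<tau> \<Longrightarrow> b l < s"
    "\<And>i l h. length i = \<tau> \<Longrightarrow> length l < \<tau> \<Longrightarrow> prefix (l @ [h]) i \<Longrightarrow> (b l \<in> a i \<longleftrightarrow> h)"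
    unfolding set_branching_def by blast
  from ab(1) have "\<forall>i. \<exists>x. length i = \<tau> \<longrightarrow> x < N \<and> a i = ?T x" by blast
  then obtain x where x: "\<And>i. length i = \<tau> \<Longrightarrow> x i < N \<and> a i = ?T (x i)" by metis
  \<comment> \<open>The witnesses are indices into the sample: a single point for place
    \<open>j\<close>, and for the other places the entries of block \<open>b l\<close>, with the
    offsets used in \<open>block\<close>.\<close>
  define a' where "a' i = (\<lambda>c\<in>{j}. x i)" for i
  define b' where "b' l = (\<lambda>c\<in>?Y. N + b l * ?k + c)" for l
  have "merge {j} ?Y (a' i, b' l) \<in> pullback ar z {..<N + s * ?k} M E \<longleftrightarrow> h"
    if il: "length i = \<tau>" "length l < \<tau>" "prefix (l @ [h]) i" for i l h
  proof -
    let ?v = "merge {j} ?Y (a' i, b' l)"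
    have v: "?v c = (if c = j then x i else if c < ?k then N + b l * ?k + c else undefined)" for c
      using j by (auto simp: merge_def a'_def b'_def)
    have "?v \<in> {..<?k} \<rightarrow>\<^sub>E {..<N + s * ?k}"
      using x[OF il(1)] block_index_less[OF ab(2)[OF il(2)], of _ ?k] j
      by (auto simp: PiE_iff v extensional_def)
    moreover have "compose {..<?k} z ?v = (block ?k N (b l) z)(j := z (x i))"
      using j by (auto simp: compose_def v block_def)
    ultimately have "?v \<in> pullback ar z {..<N + s * ?k} M E \<longleftrightarrow> b l \<in> ?T (x i)"
      using ab(2)[OF il(2)] by (simp add: pullback_def sample_trace_def)
    also have "\<dots> \<longleftrightarrow> h" using ab(3)[OF il] x[OF il(1)] by simp
    finally show ?thesis .
  qed
  moreover have "a' i \<in> {j} \<rightarrow>\<^sub>E {..<N + s * ?k}" if "length i = \<tau>" for i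
    using x[OF that] by (auto simp: a'_def)
  moreover have "b' l \<in> ?Y \<rightarrow>\<^sub>E {..<N + s * ?k}" if "length l < \<tau>" for l
    using block_index_less[OF ab(2)[OF that], of _ ?k] by (auto simp: b'_def)
  ultimately show ?thesis unfolding has_branching_def by blast
qed

section \<open>Copies of finite structures and their density\<close>

definition copies :: "('l \<Rightarrow> nat) \<Rightarrow> nat \<Rightarrow> ('l \<Rightarrow> (nat \<Rightarrow> nat) set) \<Rightarrow> ('l \<Rightarrow> (nat \<Rightarrow> real) set) \<Rightarrow> (nat \<Rightarrow> real) set" where
  "copies ar k F M = {x \<in> space (cube k). embedding ar {..<k} F {0..1} M x}"

lemma borel_measurable_cube_component: "j < k \<Longrightarrow> (\<lambda>w. w j) \<in> borel_measurable (cube k)"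
  by (rule measurable_compose[OF measurable_cube_component]) (auto intro: measurable_restrict_space1)

lemma copies_measurable:
  fixes ar :: "'l::finite \<Rightarrow> nat"
  assumes M: "borel_structure ar M"
  shows "copies ar k F M \<in> sets (cube k)"
proof -
  have eq: "copies ar k F M = {x \<in> space (cube k). (\<forall>i\<in>{..<k}. \<forall>i'\<in>{..<k}. i \<noteq> i' \<longrightarrow> x i \<noteq> x i') \<and>
     (\<forall>E\<in>UNIV. \<forall>v\<in>{..<ar E} \<rightarrow>\<^sub>E {..<k}. v \<in> F E \<longleftrightarrow> compose {..<ar E} x v \<in> M E)}"
    by (auto simp: copies_def embedding_def inj_on_def space_cube PiE_iff)
  have M': "M E \<in> sets (cube (ar E))" for E using M by (auto simp: borel_structure_def)
  show ?thesis unfolding eq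
  proof (intro sets.sets_Collect_conj sets.sets_Collect_finite_All)
    fix i i' assume "i \<in> {..<k}" "i' \<in> {..<k}"
    then have "{x \<in> space (cube k). x i \<noteq> x i'} \<in> sets (cube k)"
      by (intro borel_measurable_neq borel_measurable_cube_component) auto
    then show "{x \<in> space (cube k). i \<noteq> i' \<longrightarrow> x i \<noteq> x i'} \<in> sets (cube k)"
      by (cases "i = i'") auto
  next
    fix E v assume v: "v \<in> {..<ar E} \<rightarrow>\<^sub>E {..<k}"
    have "(\<lambda>x. compose {..<ar E} x v) \<in> measurable (cube k) (cube (ar E))"
      unfolding compose_def cube_def[of "ar E"]
      by (rule measurable_restrict) (use v in \<open>auto intro!: measurable_cube_component\<close>)
    note [measurable] = this M'
    show "{x \<in> space (cube k). v \<in> F E \<longleftrightarrow> compose {..<ar E} x v \<in> M E} \<in> sets (cube k)" by measurable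
  qed (auto intro!: finite_PiE)
qed

text \<open>As \<open>e\<close> is injective, selecting the coordinates
  \<open>e 0, ..., e (k - 1)\<close> preserves measure, and it restricts embeddings of
  \<open>F\<close> to embeddings of the substructure. Passing to a substructure thus cannot lower
  the density.\<close>

lemma measure_copies_le_t_ind:
  fixes ar :: "'l::finite \<Rightarrow> nat"
  assumes M: "borel_structure ar M" and e: "inj_on e {..<k}" "e ` {..<k} \<subseteq> {..<n}"
  shows "measure (cube n) (copies ar n F M) \<le> t_ind ar k (pullback ar e {..<k} F) M"
proof -
  define \<pi> where "\<pi> z = (\<lambda>i\<in>{..<k}. z (e i) :: real)" for z
  have \<pi>: "\<pi> \<in> measurable (cube n) (cube k)" unfolding \<pi>_def[abs_def] cube_def[of k]
    by (rule measurable_restrict) (use e in \<open>auto intro!: measurable_cube_component\<close>)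
  have d: "distr (cube n) (cube k) \<pi> = cube k"
    unfolding cube_def \<pi>_def[abs_def]
    by (rule distr_PiM_reindex) (use e in \<open>auto intro!: prob_space_unit\<close>)
  let ?T = "copies ar k (pullback ar e {..<k} F) M"
  have sub: "copies ar n F M \<subseteq> \<pi> -` ?T \<inter> space (cube n)"
  proof
    fix z assume z: "z \<in> copies ar n F M"
    then have zs: "z \<in> space (cube n)" and zi: "inj_on z {..<n}"
      and ze: "\<And>E v. v \<in> {..<ar E} \<rightarrow>\<^sub>E {..<n} \<Longrightarrow> v \<in> F E \<longleftrightarrow> compose {..<ar E} z v \<in> M E"
      by (auto simp: copies_def embedding_def)
    have "\<pi> z \<in> space (cube k)" using measurable_space[OF \<pi> zs] .
    moreover have "inj_on (\<pi> z) {..<k}"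
      using inj_on_subset[OF zi e(2)] e(1) by (auto simp: \<pi>_def inj_on_def)
    moreover have "v \<in> pullback ar e {..<k} F E \<longleftrightarrow> compose {..<ar E} (\<pi> z) v \<in> M E"
      if v: "v \<in> {..<ar E} \<rightarrow>\<^sub>E {..<k}" for E v
    proof -
      have ev: "compose {..<ar E} e v \<in> {..<ar E} \<rightarrow>\<^sub>E {..<n}" by (rule compose_in_PiE[OF v]) (use e in auto)
      have "compose {..<ar E} (\<pi> z) v = compose {..<ar E} z (compose {..<ar E} e v)"
        using v by (auto simp: compose_def \<pi>_def PiE_iff)
      then show ?thesis using ze[OF ev] v by (simp add: pullback_def)
    qed
    moreover have "\<pi> z \<in> {..<k} \<rightarrow> {0..1}" using \<open>\<pi> z \<in> space (cube k)\<close> by (auto simp: space_cube)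
    ultimately show "z \<in> \<pi> -` ?T \<inter> space (cube n)" using zs by (auto simp: copies_def embedding_def)
  qed
  have "measure (cube n) (copies ar n F M) \<le> measure (cube n) (\<pi> -` ?T \<inter> space (cube n))"
    by (intro cube_k.finite_measure_mono sub measurable_sets[OF \<pi>] copies_measurable M)
  also have "\<dots> = measure (distr (cube n) (cube k) \<pi>) ?T"
    by (rule measure_distr[symmetric]) (intro \<pi> copies_measurable M)+
  finally show ?thesis unfolding d by (simp add: t_ind_def copies_def)
qed

text \<open>Resampling coordinate \<open>i\<close> keeps \<open>z i'\<close> fixed, and a single
  point is null. Embeddings are injective by definition, so samples with a repeated point have to be
  discarded.\<close>

lemma AE_cube_inj: "AE z in cube n. inj_on z {..<n}"
proof -
  have "AE z in cube n. z i \<noteq> z i'" if i: "i < n" "i' < n" "i \<noteq> i'" for i i'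
  proof -
    let ?B = "{z \<in> space (cube n). z i = z i'}"
    have B: "?B \<in> sets (cube n)"
      using i by (intro borel_measurable_eq borel_measurable_cube_component)
    have "emeasure (cube n) ?B = (\<integral>\<^sup>+z. indicator ?B z \<partial>cube n)" using B by simp
    also have "\<dots> = (\<integral>\<^sup>+z. \<integral>\<^sup>+s. indicator ?B (z(i := s)) \<partial>unit_measure \<partial>cube n)"
      using B i by (intro nn_integral_resample) auto
    also have "\<dots> \<le> (\<integral>\<^sup>+z. 0 \<partial>cube n)"
    proof (rule nn_integral_mono)
      fix z assume "z \<in> space (cube n)"
      then have zi: "z i' \<in> {0..1}" using i by (auto simp: space_cube PiE_iff)
      then have m: "{z i'} \<in> sets unit_measure" by (auto simp: sets_restrict_space_iff)
      have "(\<integral>\<^sup>+s. indicator ?B (z(i := s)) \<partial>unit_measure) \<le> (\<integral>\<^sup>+s. indicator {z i'} s \<partial>unit_measure)"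
        using i by (intro nn_integral_mono) (auto simp: indicator_def)
      also have "\<dots> = emeasure unit_measure {z i'}" using m by simp
      also have "\<dots> = 0" using zi by (simp add: emeasure_restrict_space)
      finally show "(\<integral>\<^sup>+s. indicator ?B (z(i := s)) \<partial>unit_measure) \<le> 0" .
    qed
    finally show ?thesis using AE_iff_measurable[OF B, of "\<lambda>z. z i \<noteq> z i'"] by simp
  qed
  then have "AE z in cube n. \<forall>i\<in>{..<n}. \<forall>i'\<in>{..<n}. i \<noteq> i' \<longrightarrow> z i \<noteq> z i'"
    by (intro AE_finite_allI) auto
  then show ?thesis by eventually_elim (auto simp: inj_on_def)
qed

text \<open>If no set of fewer than \<open>N\<close> centres sufficed, samples with distinct traces
  would have measure at least \<open>\<beta> ^ N / 2\<close>, and the structures they induce branch.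
  Only finitely many structures live on the sample indices, so one of them would have copies of
  measure above \<open>\<delta>\<close>, and its minimal branching substructure would contradict the
  hypothesis on \<open>M\<close>.\<close>

lemma few_centers:
  fixes ar :: "'l::finite \<Rightarrow> nat"
  assumes j: "j < ar E" and \<beta>: "0 < \<beta>" and a: "0 \<le> a" "a \<le> 1"
    and s: "real N ^ 2 * (1 - a) ^ s \<le> 1 / 2" and N: "(s + 1) ^ (\<tau> - 1) < N"
  shows "\<exists>\<delta>>0. \<forall>M. borel_structure ar M \<and> \<not> borel_branching ar \<delta> \<tau> M \<longrightarrow>
     (\<exists>C\<subseteq>{0..1}. finite C \<and> card C < N \<and>
        emeasure unit_measure {t \<in> {0..1}. \<forall>c\<in>C. ennreal a < slice_dist (ar E) (M E) j c t} < ennreal \<beta>)"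
proof -
  let ?n = "N + s * ar E"
  define \<S> where "\<S> = {F :: 'l \<Rightarrow> (nat \<Rightarrow> nat) set. is_structure ar {..<?n} F}"
  have "\<S> = PiE UNIV (\<lambda>E. Pow ({..<ar E} \<rightarrow>\<^sub>E {..<?n}))"
    by (auto simp: \<S>_def is_structure_def PiE_iff)
  then have fin: "finite \<S>" by (auto intro!: finite_PiE)
  \<comment> \<open>Chosen so that all structures in \<open>\<S>\<close> together, each of density
    at most \<open>\<delta>\<close>, fill at most \<open>\<beta> ^ N / 4\<close>, half of what the
    sampling event occupies. It depends on the language and the numerical data, not on
    \<open>M\<close>.\<close>
  define \<delta> where "\<delta> = \<beta> ^ N / (4 * (real (card \<S>) + 1))"
  have \<delta>: "0 < \<delta>" using \<beta> by (simp add: \<delta>_def)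
  show ?thesis
  proof (intro exI[of _ \<delta>] conjI allI impI \<delta>)
    fix M assume M: "borel_structure ar M \<and> \<not> borel_branching ar \<delta> \<tau> M"
    then have bM: "borel_structure ar M" by blast
    have ME: "M E \<in> sets (cube (ar E))" using bM by (auto simp: borel_structure_def)
    let ?br = "has_branching (\<lambda>R v. v \<in> R E) {j} ({..<ar E} - {j}) \<tau>"
    have small: "measure (cube ?n) (copies ar ?n F M) \<le> \<delta>" if F: "F \<in> \<S>" "?br {..<?n} F" for F
    proof (rule ccontr)
      assume "\<not> ?thesis"
      moreover have "is_structure ar {..<?n} F" using F by (simp add: \<S>_def)
      then obtain k e where e: "inj_on e {..<k::nat}" "e ` {..<k} \<subseteq> {..<?n}"
        "minimally_has_branching ar (\<lambda>R v. v \<in> R E) {j} ({..<ar E} - {j}) \<tau> {..<k} (pullback ar e {..<k} F)"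
        using exists_minimal_branching[of j ar E "{..<?n}" F \<tau>] j F by auto
      moreover have "is_structure ar {..<k} (pullback ar e {..<k} F)"
        by (auto simp: is_structure_def pullback_def)
      moreover have "measure (cube ?n) (copies ar ?n F M) \<le> t_ind ar k (pullback ar e {..<k} F) M"
        by (rule measure_copies_le_t_ind[OF bM e(1,2)])
      ultimately have "borel_branching ar \<delta> \<tau> M"
        unfolding borel_branching_def using j
        by (intro exI[of _ E] exI[of _ j] exI[of _ k] exI[of _ "pullback ar e {..<k} F"]) auto
      then show False using M by blast
    qed
    show "\<exists>C\<subseteq>{0..1}. finite C \<and> card C < N \<and>
        emeasure unit_measure {t \<in> {0..1}. \<forall>c\<in>C. ennreal a < slice_dist (ar E) (M E) j c t} < ennreal \<beta>"
    proof (rule ccontr)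
      assume neg: "\<not> ?thesis"
      have cov: "ennreal \<beta> \<le> emeasure unit_measure {t \<in> {0..1}. \<forall>c\<in>C. ennreal a < slice_dist (ar E) (M E) j c t}"
        if "C \<subseteq> {0..1}" "finite C" "card C < N" for C
        using neg that by (meson not_less)
      define G where "G = {z \<in> space (cube ?n). inj_on (sample_trace (ar E) (M E) j N s z) {..<N}}"
      have "0 \<le> \<beta>" using \<beta> by simp
      note G = distinct_traces_measure[OF ME j a this s cov, folded G_def]
      define \<T> where "\<T> = {F \<in> \<S>. ?br {..<?n} F}"
      have finT: "finite \<T>" using fin by (simp add: \<T>_def)
      \<comment> \<open>Every sample without repetitions is a copy of the structure that it induces
        on its own indices.\<close>
      have "AE z in cube ?n. z \<in> G \<longrightarrow> z \<in> (\<Union>F\<in>\<T>. copies ar ?n F M)"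
        using AE_cube_inj
      proof eventually_elim
        case (elim z)
        show ?case
        proof
          assume z: "z \<in> G"
          let ?F = "pullback ar z {..<?n} M"
          have zs: "z \<in> space (cube ?n)" using z by (simp add: G_def)
          have "?br {..<?n} ?F"
            using z by (intro has_branching_of_distinct_traces j N) (auto simp: G_def)
          then have "?F \<in> \<T>" by (auto simp: \<T>_def \<S>_def is_structure_def pullback_def)
          moreover have "z \<in> {..<?n} \<rightarrow> {0..1}" using zs by (auto simp: space_cube)
          then have "z \<in> copies ar ?n ?F M"
            using elim zs by (auto simp: copies_def embedding_def pullback_def)
          ultimately show "z \<in> (\<Union>F\<in>\<T>. copies ar ?n F M)" by blast
        qed
      qed
      then have "measure (cube ?n) G \<le> measure (cube ?n) (\<Union>F\<in>\<T>. copies ar ?n F M)"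
        using finT copies_measurable[OF bM] by (intro cube_k.finite_measure_mono_AE) auto
      also have "\<dots> \<le> (\<Sum>F\<in>\<T>. measure (cube ?n) (copies ar ?n F M))"
        using finT copies_measurable[OF bM] by (intro measure_UNION_le) auto
      also have "\<dots> \<le> (\<Sum>F\<in>\<T>. \<delta>)" using small by (intro sum_mono) (auto simp: \<T>_def)
      also have "\<dots> \<le> real (card \<S>) * \<delta>"
        using fin \<delta> card_mono[of \<S> \<T>] by (simp add: \<T>_def mult_right_mono)
      also have "\<dots> \<le> \<beta> ^ N / 4"
      proof -
        have "real (card \<S>) * \<delta> \<le> (real (card \<S>) + 1) * \<delta>" using \<delta> by simp
        also have "\<dots> = \<beta> ^ N / 4" by (simp add: \<delta>_def field_simps)
        finally show ?thesis .
      qed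
      finally have "\<beta> ^ N / 2 \<le> \<beta> ^ N / 4" using G(2) by simp
      then show False using \<beta> by (simp add: field_simps)
    qed
  qed
qed

section \<open>Approximation from few centres\<close>

text \<open>A point goes to the first centre of a fixed enumeration within distance
  \<open>a\<close>, which makes the map measurable. Exceptional points cost at most 1 each and have
  mass below \<open>\<beta>\<close>.\<close>

lemma exists_center_map:
  assumes M: "M \<in> sets (cube k)" and j: "j < k" and C: "C \<subseteq> {0..1}" "finite C"
    and a: "0 \<le> a" and \<beta>: "0 \<le> \<beta>" "\<beta> \<le> 1"
    and small: "emeasure unit_measure {t \<in> {0..1}. \<forall>c\<in>C. ennreal a < slice_dist k M j c t} < ennreal \<beta>"
  shows "\<exists>c\<in>measurable unit_measure unit_measure. c ` {0..1} \<subseteq> C \<and>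
     (\<integral>\<^sup>+s. slice_dist k M j s (c s) \<partial>unit_measure) \<le> ennreal (a + \<beta>)"
proof -
  \<comment> \<open>With no centres every point would be exceptional, contradicting
    \<open>\<beta> \<le> 1\<close>. A default centre is therefore available.\<close>
  have "C \<noteq> {}"
  proof
    assume "C = {}"
    then have "{t \<in> {0..1}. \<forall>c\<in>C. ennreal a < slice_dist k M j c t} = space unit_measure" by auto
    then have "1 < ennreal \<beta>" using small by (simp only: unit.emeasure_space_1)
    then show False using \<beta> by (simp add: not_less[symmetric])
  qed
  then have cC: "0 < card C" using C by (simp add: card_gt_0_iff)
  obtain e where e: "bij_betw e {..<card C} C"
    using ex_bij_betw_nat_finite[OF C(2)] by (auto simp: atLeast0LessThan)
  have eC: "e i \<in> C" if "i < card C" for i using e that by (auto simp: bij_betw_def)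
  have e01: "e i \<in> space unit_measure" if "i < card C" for i using eC[OF that] C by auto
  \<comment> \<open>The value \<open>card C\<close> stands for the absence of a near centre; it
    guarantees that the least index exists, and \<open>f\<close> sends it to the default centre
    \<open>e 0\<close>.\<close>
  define idx where "idx t = (LEAST i. i = card C \<or> (i < card C \<and> slice_dist k M j (e i) t \<le> ennreal a))" for t
  define f where "f i = (if i < card C then e i else e 0)" for i
  have pm: "Measurable.pred unit_measure (\<lambda>t. i = card C \<or> (i < card C \<and> slice_dist k M j (e i) t \<le> ennreal a))" for i
  proof (cases "i < card C")
    case True
    note [measurable] = M j e01[OF True]
    show ?thesis by measurable
  next
    case False
    then show ?thesis by simp
  qed
  have idxm: "idx \<in> measurable unit_measure (count_space UNIV)"
    unfolding idx_def[abs_def] by (rule measurable_Least[OF pm])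
  have fm: "f \<in> measurable (count_space UNIV) unit_measure"
    using e01 cC by (auto simp: f_def)
  have fC: "f i \<in> C" for i using eC cC by (simp add: f_def)
  define c where "c = (\<lambda>t. f (idx t))"
  have cm: "c \<in> measurable unit_measure unit_measure"
    unfolding c_def by (rule measurable_compose[OF idxm fm])
  let ?X = "{t \<in> {0..1}. \<forall>c\<in>C. ennreal a < slice_dist k M j c t}"
  have "?X = {t \<in> space unit_measure. \<forall>c\<in>C. ennreal a < slice_dist k M j c t}" by simp
  also have "\<dots> \<in> sets unit_measure"
  proof (rule sets.sets_Collect_finite_All[OF _ C(2)])
    fix c assume "c \<in> C"
    then have [measurable]: "c \<in> space unit_measure" using C by auto
    note [measurable] = M j
    show "{t \<in> space unit_measure. ennreal a < slice_dist k M j c t} \<in> sets unit_measure" by measurable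
  qed
  finally have X: "?X \<in> sets unit_measure" .
  have le: "slice_dist k M j t (c t) \<le> ennreal a + indicator ?X t" if t: "t \<in> space unit_measure" for t
  proof (cases "t \<in> ?X")
    case True
    then show ?thesis using slice_dist_le_1[of k M j t "c t"] by (simp add: add_increasing)
  next
    case False
    then obtain x where x: "x \<in> C" "slice_dist k M j x t \<le> ennreal a" using t by (auto simp: not_less)
    obtain i where i: "i < card C" "e i = x"
      using x(1) bij_betw_imp_surj_on[OF e] by (metis imageE lessThan_iff)
    then have "idx t \<le> i" unfolding idx_def using x by (intro Least_le) auto
    then have "idx t < card C" using i by simp
    moreover have "idx t = card C \<or> (idx t < card C \<and> slice_dist k M j (e (idx t)) t \<le> ennreal a)"
      unfolding idx_def by (rule LeastI[of _ "card C"]) simp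
    ultimately have "slice_dist k M j (c t) t \<le> ennreal a" by (simp add: c_def f_def)
    then show ?thesis by (simp add: slice_dist_sym[of k M j t] add_increasing2)
  qed
  have "(\<integral>\<^sup>+t. slice_dist k M j t (c t) \<partial>unit_measure) \<le> (\<integral>\<^sup>+t. ennreal a + indicator ?X t \<partial>unit_measure)"
    by (rule nn_integral_mono) (rule le)
  also have "\<dots> = (\<integral>\<^sup>+t. ennreal a \<partial>unit_measure) + (\<integral>\<^sup>+t. indicator ?X t \<partial>unit_measure)"
    using X by (intro nn_integral_add) auto
  also have "\<dots> = ennreal a + emeasure unit_measure ?X"
    using X unit.emeasure_space_1 by (simp add: nn_integral_indicator[OF X])
  also have "\<dots> \<le> ennreal a + ennreal \<beta>" using small by (intro add_left_mono less_imp_le)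
  also have "\<dots> = ennreal (a + \<beta>)" using a \<beta> by simp
  finally show ?thesis using cm fC by (intro bexI[OF _ cm]) (auto simp: c_def)
qed

text \<open>In general the pieces have size \<open>1 / m\<close> with leftover at most
  \<open>card V / m\<close>. A constant \<open>\<kappa>\<close> is treated apart: the single part
  \<open>[0,1]\<close> lies in one fibre and nothing is left over, although that quotient is not
  small.\<close>

lemma equitable_borel_partition:
  fixes \<kappa> :: "real \<Rightarrow> 'b"
  assumes V: "finite V" "\<kappa> ` {0..1} \<subseteq> V" and fib: "\<And>v. v \<in> V \<Longrightarrow> {x \<in> {0..1}. \<kappa> x = v} \<in> sets borel"
    and m: "0 < m" and u: "0 \<le> u" and small: "card V \<le> 1 \<and> m = 1 \<or> real (card V) / real m \<le> u"
  shows "\<exists>P U. partition_on {0..1} P \<and> finite P \<and> card P = m \<and> P \<subseteq> sets borel \<and>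
     (\<forall>p\<in>P. emeasure lborel p = ennreal (1 / real m)) \<and> U \<in> sets borel \<and> U \<subseteq> {0..1} \<and>
     emeasure lborel U \<le> ennreal u \<and> (\<forall>p\<in>P. p \<subseteq> U \<or> (\<exists>v. \<forall>x\<in>p. \<kappa> x = v))"
proof (cases "card V \<le> 1 \<and> m = 1")
  case True
  have V1: "\<forall>a\<in>V. \<forall>b\<in>V. a = b" using True card_le_Suc0_iff_eq[OF V(1)] by simp
  have "\<forall>x\<in>{0..1}. \<kappa> x = \<kappa> 0"
  proof
    fix x :: real assume "x \<in> {0..1}"
    then have "\<kappa> x \<in> V" "\<kappa> 0 \<in> V" using V(2) by auto
    then show "\<kappa> x = \<kappa> 0" using V1 by blast
  qed
  then have "\<exists>v. \<forall>x\<in>{0..1}. \<kappa> x = v" by blast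
  moreover have "partition_on {0..1::real} {{0..1}}" by (auto simp: partition_on_def disjoint_def)
  ultimately show ?thesis using True u by (intro exI[of _ "{{0..1}}"] exI[of _ "{}"]) auto
next
  case False
  then have small': "real (card V) * (1 / real m) \<le> u" using small by auto
  obtain r where r: "m = Suc r" using m by (cases m) auto
  obtain P U where PU: "partition_on {0..1} P" "finite P" "card P = Suc r" "P \<subseteq> sets borel"
     "\<forall>p\<in>P. measure lborel p = 1 / real m" "U \<in> sets borel" "U \<subseteq> {0..1}"
     "measure lborel U \<le> real (card V) * (1 / real m)" "\<forall>p\<in>P. p \<subseteq> U \<or> (\<exists>v. \<forall>x\<in>p. \<kappa> x = v)"
    using equitable_pieces[of "1 / real m" "{0..1}" r V \<kappa>] V fib m r by auto
  have "emeasure lborel A = ennreal (measure lborel A)" if "A \<in> sets borel" "A \<subseteq> {0..1}" for A :: "real set"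
    using fmeasurable_unit_subset[OF that] by (intro emeasure_eq_measure2)
  moreover have "p \<subseteq> {0..1}" if "p \<in> P" for p using partition_onD1[OF PU(1)] that by auto
  ultimately have "\<forall>p\<in>P. emeasure lborel p = ennreal (1 / real m)"
      "emeasure lborel U = ennreal (measure lborel U)"
    using PU(4-7) by auto
  moreover have "ennreal (measure lborel U) \<le> ennreal u" using PU(8) small' by (intro ennreal_leI) simp
  ultimately have "\<forall>p\<in>P. emeasure lborel p = ennreal (1 / real m)" "emeasure lborel U \<le> ennreal u" "card P = m"
    using PU(3) r by simp_all
  then show ?thesis using PU(1,2,4,6,7,9) by blast
qed

text \<open>The centre maps of all relations and coordinates are combined into one map
  \<open>\<kappa>\<close>, whose fibres form the common refinement. There are at most
  \<open>lang_n ar\<close> maps with at most \<open>K\<close> values each, hence at most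
  \<open>K ^ lang_n ar\<close> fibres. With \<open>\<theta> = \<eta>\<close> and
  \<open>u = \<eta> / 2\<close> the step approximation costs \<open>6 * \<eta>\<close> per
  coordinate.\<close>

lemma borel_structure_approximation:
  fixes ar :: "'l::finite \<Rightarrow> nat"
  assumes M: "borel_structure ar M" and \<eta>: "0 < \<eta>" "\<eta> \<le> 1" and m: "0 < m"
    and C: "\<And>E j. j < ar E \<Longrightarrow> \<exists>C\<subseteq>{0..1}. finite C \<and> card C \<le> K \<and>
       emeasure unit_measure {t \<in> {0..1}. \<forall>c\<in>C. ennreal (\<eta> / 2) < slice_dist (ar E) (M E) j c t} < ennreal (\<eta> / 2)"
    and K: "1 \<le> K" "K = 1 \<and> m = 1 \<or> real (K ^ lang_n ar) / real m \<le> \<eta> / 2"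
  shows "\<exists>Mp P. borel_structure ar Mp \<and> borel_partition P \<and> equitable P \<and>
     d1 ar M Mp \<le> 6 * real (max_arity ar) * real CARD('l) * \<eta> \<and> indivisible ar P Mp \<and> finite P \<and> card P = m"
proof -
  have ME: "M E \<in> sets (cube (ar E))" for E using M by (auto simp: borel_structure_def)
  have ar: "ar E \<le> max_arity ar" for E unfolding max_arity_def by (intro Max_ge) auto
  define Q where "Q = (SIGMA E:UNIV. {..<ar E})"
  have finQ: "finite Q" by (auto simp: Q_def)
  have "card Q = (\<Sum>E\<in>UNIV. ar E)" by (simp add: Q_def)
  also have "\<dots> \<le> (\<Sum>E\<in>(UNIV :: 'l set). max_arity ar)" using ar by (intro sum_mono)
  finally have cardQ: "card Q \<le> lang_n ar" by (simp add: lang_n_def)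
  define R where "R q D c \<longleftrightarrow> finite D \<and> card D \<le> K \<and> c \<in> measurable unit_measure unit_measure \<and> c ` {0..1} \<subseteq> D \<and>
      (\<integral>\<^sup>+s. slice_dist (ar (fst q)) (M (fst q)) (snd q) s (c s) \<partial>unit_measure) \<le> ennreal \<eta>" for q D c
  have "\<exists>D c. R q D c" if "q \<in> Q" for q
  proof -
    have j: "snd q < ar (fst q)" using that by (auto simp: Q_def)
    obtain D where D: "D \<subseteq> {0..1}" "finite D" "card D \<le> K"
       "emeasure unit_measure {t \<in> {0..1}. \<forall>c\<in>D. ennreal (\<eta> / 2) < slice_dist (ar (fst q)) (M (fst q)) (snd q) c t} < ennreal (\<eta> / 2)"
      using C[OF j] by blast
    have "0 \<le> \<eta> / 2" "\<eta> / 2 \<le> 1" using \<eta> by auto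
    from exists_center_map[OF ME j D(1,2) this(1) this D(4)]
    obtain c where "c \<in> measurable unit_measure unit_measure" "c ` {0..1} \<subseteq> D"
      "(\<integral>\<^sup>+s. slice_dist (ar (fst q)) (M (fst q)) (snd q) s (c s) \<partial>unit_measure) \<le> ennreal \<eta>" by auto
    then have "R q D c" using D(2,3) by (simp add: R_def)
    then show ?thesis by blast
  qed
  then have "\<forall>q\<in>Q. \<exists>D. \<exists>c. R q D c" by blast
  from bchoice[OF this] obtain D where "\<forall>q\<in>Q. \<exists>c. R q (D q) c" by blast
  from bchoice[OF this] obtain c where "\<forall>q\<in>Q. R q (D q) (c q)" by blast
  then have Dc: "\<And>q. q \<in> Q \<Longrightarrow> finite (D q)" "\<And>q. q \<in> Q \<Longrightarrow> card (D q) \<le> K"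
      "\<And>q. q \<in> Q \<Longrightarrow> c q \<in> measurable unit_measure unit_measure" "\<And>q. q \<in> Q \<Longrightarrow> c q ` {0..1} \<subseteq> D q"
      "\<And>q. q \<in> Q \<Longrightarrow> (\<integral>\<^sup>+s. slice_dist (ar (fst q)) (M (fst q)) (snd q) s (c q s) \<partial>unit_measure) \<le> ennreal \<eta>"
    by (simp_all add: R_def)
  define V where "V = PiE Q D"
  define \<kappa> where "\<kappa> x = (\<lambda>q\<in>Q. c q x)" for x
  have "\<kappa> x \<in> V" if "x \<in> {0..1}" for x
    unfolding \<kappa>_def V_def using Dc(4) that by (intro restrict_PiE_iff[THEN iffD2] ballI) blast
  moreover have "finite V" unfolding V_def using finQ Dc(1) by (intro finite_PiE)
  ultimately have V: "finite V" "\<kappa> ` {0..1} \<subseteq> V" by blast+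
  have "card V = (\<Prod>q\<in>Q. card (D q))" unfolding V_def by (rule card_PiE[OF finQ])
  also have "\<dots> \<le> (\<Prod>q\<in>Q. K)" using Dc(2) by (intro prod_mono) auto
  also have "\<dots> \<le> K ^ lang_n ar" using cardQ K(1) by (simp add: power_increasing)
  finally have cardV: "card V \<le> K ^ lang_n ar" .
  have fib: "{x \<in> {0..1}. \<kappa> x = v} \<in> sets borel" if "v \<in> V" for v
  proof -
    have "{x \<in> {0..1}. \<kappa> x = v} = {x \<in> space unit_measure. \<forall>q\<in>Q. c q x = v q}"
      using that by (auto simp: \<kappa>_def V_def PiE_iff fun_eq_iff extensional_def)
    also have "\<dots> \<in> sets unit_measure"
    proof (rule sets.sets_Collect_finite_All[OF _ finQ])
      fix q assume q: "q \<in> Q"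
      have "c q \<in> borel_measurable unit_measure"
        by (rule measurable_compose[OF Dc(3)[OF q]]) (auto intro: measurable_restrict_space1)
      then show "{x \<in> space unit_measure. c q x = v q} \<in> sets unit_measure"
        by (intro borel_measurable_eq) auto
    qed
    finally show ?thesis by (auto simp: sets_restrict_space)
  qed
  have small: "card V \<le> 1 \<and> m = 1 \<or> real (card V) / real m \<le> \<eta> / 2"
    using K(2)
  proof
    assume "K = 1 \<and> m = 1"
    then show ?thesis using cardV by simp
  next
    assume "real (K ^ lang_n ar) / real m \<le> \<eta> / 2"
    moreover have "real (card V) / real m \<le> real (K ^ lang_n ar) / real m"
      using cardV by (intro divide_right_mono) (simp_all only: of_nat_le_iff of_nat_0_le_iff)
    ultimately show ?thesis by linarith
  qed
  obtain P U where PU: "partition_on {0..1} P" "finite P" "card P = m" "P \<subseteq> sets borel"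
     "\<And>p. p \<in> P \<Longrightarrow> emeasure lborel p = ennreal (1 / real m)" "U \<in> sets borel" "U \<subseteq> {0..1}"
     "emeasure lborel U \<le> ennreal (\<eta> / 2)" "\<And>p. p \<in> P \<Longrightarrow> p \<subseteq> U \<or> (\<exists>v. \<forall>x\<in>p. \<kappa> x = v)"
    using equitable_borel_partition[OF V fib m _ small] \<eta> by auto
  define T where "T E N \<longleftrightarrow> (\<forall>p\<in>{..<ar E} \<rightarrow>\<^sub>E P. \<forall>x\<in>PiE {..<ar E} p. \<forall>y\<in>PiE {..<ar E} p. x \<in> N \<longleftrightarrow> y \<in> N) \<and>
     (\<integral>\<^sup>+w. ennreal \<bar>indicat_real (M E) w - indicat_real N w\<bar> \<partial>cube (ar E)) \<le> ennreal (4 * real (ar E) * (\<eta> + \<eta> / 2))" for E N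
  have "\<exists>N\<in>sets (cube (ar E)). T E N" for E
    unfolding T_def
  proof (rule step_set_approximation[OF ME PU(1,2,4,5) _ PU(6-8), where c = "\<lambda>j. c (E, j)"])
    show "0 < real m" using m by simp
    show "0 \<le> \<eta> / 2" "0 \<le> \<eta>" using \<eta> by auto
    fix j assume "j < ar E"
    then have q: "(E, j) \<in> Q" by (simp add: Q_def)
    show "c (E, j) \<in> measurable unit_measure unit_measure" by (rule Dc(3)[OF q])
    show "(\<integral>\<^sup>+s. slice_dist (ar E) (M E) j s (c (E, j) s) \<partial>unit_measure) \<le> ennreal \<eta>" using Dc(5)[OF q] by simp
    fix p assume "p \<in> P"
    then show "p \<subseteq> U \<or> (\<exists>v. \<forall>x\<in>p. c (E, j) x = v)"
    proof -
      have "c (E, j) x = v (E, j)" if "\<kappa> x = v" for x v using that q by (auto simp: \<kappa>_def)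
      then show ?thesis using PU(9)[OF \<open>p \<in> P\<close>] by blast
    qed
  qed
  then have "\<forall>E. \<exists>N. N \<in> sets (cube (ar E)) \<and> T E N" by blast
  from choice[OF this] obtain N where NT: "\<forall>E. N E \<in> sets (cube (ar E)) \<and> T E (N E)" by blast
  have N: "N E \<in> sets (cube (ar E))"
     "p \<in> {..<ar E} \<rightarrow>\<^sub>E P \<Longrightarrow> x \<in> PiE {..<ar E} p \<Longrightarrow> y \<in> PiE {..<ar E} p \<Longrightarrow> x \<in> N E \<longleftrightarrow> y \<in> N E"
     "(\<integral>\<^sup>+w. ennreal \<bar>indicat_real (M E) w - indicat_real (N E) w\<bar> \<partial>cube (ar E)) \<le> ennreal (4 * real (ar E) * (\<eta> + \<eta> / 2))"
    for E p x y
    using NT[rule_format, of E] unfolding T_def by blast+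
  have "borel_structure ar N"
    using N(1) sets.sets_into_space[OF N(1)] by (auto simp: borel_structure_def is_structure_def space_cube)
  moreover have "borel_partition P" using PU by (auto simp: borel_partition_def intro: countable_finite)
  moreover have "equitable P" using PU(5) by (simp add: equitable_def)
  moreover have "indivisible ar P N"
    unfolding indivisible_def
  proof (intro allI ballI)
    fix E p x y assume "p \<in> {..<ar E} \<rightarrow>\<^sub>E P" "x \<in> PiE {..<ar E} p" "y \<in> PiE {..<ar E} p"
    from N(2)[OF this] show "indicat_real (N E) x = indicat_real (N E) y" by (auto simp: indicator_def)
  qed
  moreover have "d1 ar M N \<le> 6 * real (max_arity ar) * real CARD('l) * \<eta>"
  proof -
    have "(\<integral>w. \<bar>indicat_real (M E) w - indicat_real (N E) w\<bar> \<partial>cube (ar E)) \<le> 6 * real (max_arity ar) * \<eta>" for E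
    proof -
      have "(\<lambda>w. \<bar>indicat_real (M E) w - indicat_real (N E) w\<bar>) \<in> borel_measurable (cube (ar E))"
        using ME[of E] N(1)[of E] by measurable
      then have "(\<integral>w. \<bar>indicat_real (M E) w - indicat_real (N E) w\<bar> \<partial>cube (ar E)) =
         enn2real (\<integral>\<^sup>+w. ennreal \<bar>indicat_real (M E) w - indicat_real (N E) w\<bar> \<partial>cube (ar E))"
        by (intro integral_eq_nn_integral) auto
      also have "\<dots> \<le> 4 * real (ar E) * (\<eta> + \<eta> / 2)" using \<eta> by (intro enn2real_leI N(3)) simp
      also have "\<dots> = 6 * real (ar E) * \<eta>" by simp
      also have "\<dots> \<le> 6 * real (max_arity ar) * \<eta>" using ar[of E] \<eta> by simp
      finally show ?thesis .
    qed
    then have "d1 ar M N \<le> (\<Sum>E\<in>(UNIV :: 'l set). 6 * real (max_arity ar) * \<eta>)"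
      unfolding d1_def by (intro sum_mono)
    then show ?thesis by (simp add: mult.commute mult.left_commute)
  qed
  ultimately show ?thesis using PU(2,3) by blast
qed

text \<open>Empty relations are indivisible for the single part \<open>[0,1]\<close> and lie at
  distance at most 1 per symbol; this serves large \<open>\<epsilon>\<close>.\<close>

lemma trivial_approximation:
  fixes ar :: "'l::finite \<Rightarrow> nat"
  assumes M: "borel_structure ar M"
  shows "\<exists>Mp P. borel_structure ar Mp \<and> borel_partition P \<and> equitable P \<and>
     d1 ar M Mp \<le> real CARD('l) \<and> indivisible ar P Mp \<and> finite P \<and> card P = 1"
proof (intro exI[of _ "\<lambda>_. {}"] exI[of _ "{{0..1::real}}"] conjI)
  show "borel_partition {{0..1}}" by (auto simp: borel_partition_def partition_on_def disjoint_def)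
  have "(\<integral>w. \<bar>indicat_real (M E) w - indicat_real {} w\<bar> \<partial>cube (ar E)) \<le> 1" for E
  proof -
    have "M E \<in> sets (cube (ar E))" using M by (auto simp: borel_structure_def)
    then have "(\<integral>w. \<bar>indicat_real (M E) w - indicat_real {} w\<bar> \<partial>cube (ar E)) = measure (cube (ar E)) (M E)"
      by simp
    then show ?thesis by simp
  qed
  then have "d1 ar M (\<lambda>_. {}) \<le> (\<Sum>E\<in>(UNIV :: 'l set). 1)"
    unfolding d1_def by (intro sum_mono)
  then show "d1 ar M (\<lambda>_. {}) \<le> real CARD('l)" by simp
qed (auto simp: borel_structure_def is_structure_def equitable_def indivisible_def)

section \<open>Numerical bounds\<close>

text \<open>Here \<open>s = S ^ 2 - 1\<close> and \<open>N = (s + 1) ^ (\<tau> - 1) + 1\<close>. The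
  square is taken because \<open>s = (S - 1) * (S + 1)\<close>: the estimate
  \<open>S \<le> exp (S - 1)\<close> turns the power of \<open>S\<close> into an exponential of a
  multiple of \<open>S - 1\<close>, and \<open>a * (S + 1)\<close> dominates that multiple. So
  \<open>S\<close> linear in \<open>\<tau> / a\<close> is enough, with no logarithm.\<close>

lemma sample_size_sufficient:
  fixes a :: real
  assumes a: "0 < a" "a \<le> 1" and S: "2 \<le> S" "(4 * real \<tau> + 3) / a \<le> real S"
  shows "real ((S ^ 2) ^ (\<tau> - 1) + 1) ^ 2 * (1 - a) ^ (S ^ 2 - 1) \<le> 1 / 2"
proof -
  define d where "d = \<tau> - 1"
  have d: "real d \<le> real \<tau>" by (simp add: d_def)
  have Sexp: "real S \<le> exp (real S - 1)" using exp_ge_add_one_self[of "real S - 1"] by simp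
  have "real ((S ^ 2) ^ d + 1) \<le> 2 * real S ^ (2 * d)"
  proof -
    have "1 \<le> real S ^ (2 * d)" using S by (intro one_le_power) simp
    then show ?thesis by (simp add: power_mult)
  qed
  then have "real ((S ^ 2) ^ d + 1) ^ 2 \<le> (2 * real S ^ (2 * d)) ^ 2" by (intro power_mono) auto
  also have "\<dots> = 4 * real S ^ (4 * d)" by (simp add: power_mult_distrib flip: power_mult)
  finally have N: "real ((S ^ 2) ^ d + 1) ^ 2 \<le> 4 * real S ^ (4 * d)" .
  \<comment> \<open>The additional exponent 3 absorbs the constant 8, since
    \<open>2 \<le> S\<close>.\<close>
  have "2 * (4 * real S ^ (4 * d)) \<le> real S ^ 3 * real S ^ (4 * d)"
  proof -
    have "(2::real) ^ 3 \<le> real S ^ 3" using S by (intro power_mono) auto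
    then show ?thesis using mult_right_mono[of 8 "real S ^ 3" "real S ^ (4 * d)"] by simp
  qed
  also have "\<dots> = real S ^ (4 * d + 3)" by (simp add: power_add mult.commute)
  also have "\<dots> \<le> exp (real S - 1) ^ (4 * d + 3)" using Sexp by (intro power_mono) auto
  also have "\<dots> = exp (real (4 * d + 3) * (real S - 1))" by (rule exp_of_nat_mult[symmetric])
  also have "\<dots> \<le> exp (a * real (S ^ 2 - 1))"
  proof -
    have "4 * real \<tau> + 3 \<le> a * real S" using S(2) a by (simp add: field_simps)
    also have "\<dots> \<le> a * (real S + 1)" using a by simp
    finally have "real (4 * d + 3) \<le> a * (real S + 1)" using d by simp
    then have "real (4 * d + 3) * (real S - 1) \<le> a * (real S + 1) * (real S - 1)"
      using S by (intro mult_right_mono) auto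
    also have "\<dots> = a * real (S ^ 2 - 1)" using S by (simp add: of_nat_diff power2_eq_square algebra_simps)
    finally show ?thesis by simp
  qed
  finally have B: "2 * (4 * real S ^ (4 * d)) \<le> exp (a * real (S ^ 2 - 1))" .
  have "(1 - a) ^ (S ^ 2 - 1) \<le> exp (- a) ^ (S ^ 2 - 1)"
    using a exp_ge_add_one_self[of "- a"] by (intro power_mono) auto
  also have "\<dots> = exp (- (a * real (S ^ 2 - 1)))" by (simp add: exp_of_nat_mult[symmetric] mult.commute)
  finally have "real ((S ^ 2) ^ d + 1) ^ 2 * (1 - a) ^ (S ^ 2 - 1) \<le>
      4 * real S ^ (4 * d) * exp (- (a * real (S ^ 2 - 1)))"
    using N a by (intro mult_mono) auto
  also have "\<dots> \<le> exp (a * real (S ^ 2 - 1)) / 2 * exp (- (a * real (S ^ 2 - 1)))"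
    using B by (intro mult_right_mono) auto
  also have "\<dots> = 1 / 2" by (simp add: exp_minus)
  finally show ?thesis by (simp add: d_def)
qed

text \<open>All quantities are compared with powers of \<open>x = 1 / \<eta>\<close>. With
  \<open>L = log 2 \<tau>\<close> one gets \<open>S \<le> x powr (4 * L)\<close>, and the resulting
  exponent \<open>8 * L * (\<tau> - 1) * n\<close> is below \<open>2 * g\<close> thanks to the
  factor 5 in \<open>g\<close>. The remaining factor \<open>3 * x\<close> is at most
  \<open>x ^ 2\<close>, and \<open>2 * g + 2 \<le> (g + 1) * (g + 2)\<close>.\<close>

lemma parts_bound:
  fixes \<eta> :: real and \<tau> n S m :: nat and g :: int
  assumes \<tau>: "2 \<le> \<tau>" and n: "1 \<le> n" and \<eta>: "0 < \<eta>" "\<eta> \<le> 1 / 6"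
    and g: "g = \<lceil>5 * real n * real \<tau> * log 2 (real \<tau>)\<rceil>"
    and S: "real S \<le> (8 * real \<tau> + 7) / \<eta>" "1 \<le> S"
    and m: "real m \<le> 2 * real (((S ^ 2) ^ (\<tau> - 1)) ^ n) / \<eta> + 1"
  shows "real m \<le> \<eta> powi (- ((g + 1) * (g + 2)))"
proof -
  define x where "x = 1 / \<eta>"
  have x: "6 \<le> x" using \<eta> by (simp add: x_def field_simps)
  define L where "L = log 2 (real \<tau>)"
  have L1: "1 \<le> L" unfolding L_def using \<tau> by (simp add: le_log_iff)
  have \<tau>2: "real \<tau> = 2 powr L" using \<tau> by (simp add: L_def)
  also have "\<dots> \<le> x powr L" using x L1 by (intro powr_mono2) auto
  finally have \<tau>x: "real \<tau> \<le> x powr L" .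
  have "real S \<le> (12 * real \<tau>) * x"
  proof -
    have "(8 * real \<tau> + 7) / \<eta> \<le> (12 * real \<tau>) / \<eta>" using \<tau> \<eta> by (intro divide_right_mono) auto
    with S(1) show ?thesis by (simp add: x_def)
  qed
  also have "\<dots> \<le> (x ^ 2 * x powr L) * x"
  proof -
    have "12 \<le> x ^ 2" using power_mono[OF x, of 2] by simp
    then show ?thesis using \<tau>x x by (intro mult_right_mono mult_mono) auto
  qed
  also have "\<dots> = x powr (L + 3)"
    using x by (simp add: powr_add powr_numeral power2_eq_square power3_eq_cube)
  \<comment> \<open>\<open>1 \<le> L\<close>, that is \<open>2 \<le> \<tau>\<close>, allows the
    additive 3 to be absorbed into a factor.\<close>
  also have "\<dots> \<le> x powr (4 * L)" using x L1 by (intro powr_mono) auto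
  finally have Sx: "real S \<le> x powr (4 * L)" .
  have g1: "5 * real n * real \<tau> * L \<le> real_of_int g" unfolding g L_def by (rule le_of_int_ceiling)
  have "real (((S ^ 2) ^ (\<tau> - 1)) ^ n) = real S ^ (2 * (\<tau> - 1) * n)" by (simp add: power_mult)
  also have "\<dots> \<le> (x powr (4 * L)) ^ (2 * (\<tau> - 1) * n)" using Sx by (intro power_mono) auto
  also have "\<dots> = x powr (4 * L * real (2 * (\<tau> - 1) * n))"
    using x by (simp add: powr_powr powr_realpow[symmetric])
  also have "\<dots> \<le> x powr (2 * real_of_int g)"
  proof (rule powr_mono)
    have "4 * L * real (2 * (\<tau> - 1) * n) \<le> 4 * L * real (2 * \<tau> * n)"
      using L1 by (intro mult_left_mono of_nat_mono mult_le_mono) auto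
    also have "\<dots> \<le> 2 * (5 * real n * real \<tau> * L)" using L1 by simp
    also have "\<dots> \<le> 2 * real_of_int g" by (intro mult_left_mono g1) simp
    finally show "4 * L * real (2 * (\<tau> - 1) * n) \<le> 2 * real_of_int g" .
  qed (use x in simp)
  finally have K: "real (((S ^ 2) ^ (\<tau> - 1)) ^ n) \<le> x powr (2 * real_of_int g)" .
  have g0: "0 \<le> real_of_int g"
  proof -
    have "0 \<le> 5 * real n * real \<tau> * L" using L1 by simp
    then show ?thesis using g1 by linarith
  qed
  let ?K = "real (((S ^ 2) ^ (\<tau> - 1)) ^ n)"
  have K1: "1 \<le> ?K" using S(2) by simp
  have "real m \<le> 2 * ?K * x + 1" using m by (simp add: x_def)
  also have "\<dots> \<le> 2 * ?K * x + ?K * x"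
    using mult_mono[of 1 ?K 1 x] K1 x by (simp add: mult.commute)
  also have "\<dots> = ?K * (3 * x)" by simp
  also have "\<dots> \<le> x powr (2 * real_of_int g) * x ^ 2"
    using K x by (intro mult_mono) (auto simp: power2_eq_square)
  also have "\<dots> = x powr (2 * real_of_int g + 2)" using x by (simp add: powr_add powr_numeral)
  also have "\<dots> \<le> x powr (real_of_int ((g + 1) * (g + 2)))"
  proof (rule powr_mono)
    have "0 \<le> real_of_int g * real_of_int g" by simp
    then show "2 * real_of_int g + 2 \<le> real_of_int ((g + 1) * (g + 2))"
      using g0 by (simp add: algebra_simps)
  qed (use x in simp)
  also have "\<dots> = x powi ((g + 1) * (g + 2))" using x by (intro powr_real_of_int') auto
  also have "\<dots> = \<eta> powi (- ((g + 1) * (g + 2)))"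
    by (simp add: x_def power_int_minus power_int_divide_distrib divide_inverse flip: power_int_inverse)
  finally show ?thesis .
qed

section \<open>The approximation theorem\<close>

lemma real_nat_ceiling_le: "0 \<le> x \<Longrightarrow> real (nat \<lceil>x\<rceil>) \<le> x + 1"
  using of_int_ceiling_le_add_one[of x] by simp

lemma borel_branching_antimono: "borel_branching ar \<delta>' \<tau> M \<Longrightarrow> \<delta> \<le> \<delta>' \<Longrightarrow> borel_branching ar \<delta> \<tau> M"
  unfolding borel_branching_def by (meson order.trans)

text \<open>Each relation and coordinate has its own threshold. Absence of branching at some density
  implies absence at every larger one, so the minimum of the thresholds serves all of them at
  once.\<close>

lemma non_branching_approximation:
  fixes ar :: "'l::finite \<Rightarrow> nat"
  assumes \<eta>: "0 < \<eta>" "\<eta> \<le> 1" and m: "0 < m"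
    and s: "real N ^ 2 * (1 - \<eta> / 2) ^ s \<le> 1 / 2" and N: "(s + 1) ^ (\<tau> - 1) < N" "2 \<le> N"
    and K: "N = 2 \<and> m = 1 \<or> real ((N - 1) ^ lang_n ar) / real m \<le> \<eta> / 2"
  shows "\<exists>\<delta>>0. \<forall>M. borel_structure ar M \<and> \<not> borel_branching ar \<delta> \<tau> M \<longrightarrow>
    (\<exists>Mp P. borel_structure ar Mp \<and> borel_partition P \<and> equitable P \<and>
     d1 ar M Mp \<le> 6 * real (max_arity ar) * real CARD('l) * \<eta> \<and> indivisible ar P Mp \<and> finite P \<and> card P = m)"
proof -
  define Q where "Q = (SIGMA E:UNIV. {..<ar E})"
  define good where "good q \<delta> \<longleftrightarrow> 0 < \<delta> \<and> (\<forall>M. borel_structure ar M \<and> \<not> borel_branching ar \<delta> \<tau> M \<longrightarrow>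
     (\<exists>C\<subseteq>{0..1}. finite C \<and> card C < N \<and>
        emeasure unit_measure {t \<in> {0..1}. \<forall>c\<in>C. ennreal (\<eta> / 2) < slice_dist (ar (fst q)) (M (fst q)) (snd q) c t}
          < ennreal (\<eta> / 2)))" for q \<delta>
  have "\<exists>\<delta>. good q \<delta>" if "q \<in> Q" for q
  proof -
    have "snd q < ar (fst q)" using that by (auto simp: Q_def)
    then show ?thesis unfolding good_def
      by (rule few_centers[OF _ _ _ _ s N(1)]) (use \<eta> in auto)
  qed
  then have "\<forall>q\<in>Q. \<exists>\<delta>. good q \<delta>" by blast
  from bchoice[OF this] obtain d where d: "\<forall>q\<in>Q. good q (d q)" by blast
  have finQ: "finite Q" by (auto simp: Q_def)
  \<comment> \<open>The element 1 keeps the minimum defined when all symbols have arity 0.\<close>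
  define \<delta> where "\<delta> = Min (insert 1 (d ` Q))"
  have \<delta>: "0 < \<delta>" using finQ d by (auto simp: \<delta>_def good_def)
  have \<delta>_le: "\<delta> \<le> d q" if "q \<in> Q" for q using finQ that by (auto simp: \<delta>_def)
  show ?thesis
  proof (intro exI[of _ \<delta>] conjI allI impI \<delta>)
    fix M assume M: "borel_structure ar M \<and> \<not> borel_branching ar \<delta> \<tau> M"
    show "\<exists>Mp P. borel_structure ar Mp \<and> borel_partition P \<and> equitable P \<and>
       d1 ar M Mp \<le> 6 * real (max_arity ar) * real CARD('l) * \<eta> \<and> indivisible ar P Mp \<and> finite P \<and> card P = m"
    proof (rule borel_structure_approximation[OF _ \<eta> m])
      show "borel_structure ar M" using M by blast
      show "1 \<le> N - 1" using N(2) by simp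
      show "N - 1 = 1 \<and> m = 1 \<or> real ((N - 1) ^ lang_n ar) / real m \<le> \<eta> / 2" using K by auto
      fix E j assume "j < ar E"
      then have q: "(E, j) \<in> Q" by (simp add: Q_def)
      have "\<not> borel_branching ar (d (E, j)) \<tau> M"
        using M borel_branching_antimono[OF _ \<delta>_le[OF q]] by blast
      then obtain C where "C \<subseteq> {0..1}" "finite C" "card C < N"
        "emeasure unit_measure {t \<in> {0..1}. \<forall>c\<in>C. ennreal (\<eta> / 2) < slice_dist (ar E) (M E) j c t} < ennreal (\<eta> / 2)"
        using d[rule_format, OF q] M unfolding good_def fst_conv snd_conv by blast
      then show "\<exists>C\<subseteq>{0..1}. finite C \<and> card C \<le> N - 1 \<and>
        emeasure unit_measure {t \<in> {0..1}. \<forall>c\<in>C. ennreal (\<eta> / 2) < slice_dist (ar E) (M E) j c t} < ennreal (\<eta> / 2)"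
        by (intro exI[of _ C]) auto
    qed
  qed
qed

theorem mainTheorem4:
  fixes ar :: "'l::finite \<Rightarrow> nat" and \<tau> :: nat and g :: int and \<epsilon> :: real
  assumes "0 < max_arity ar"
    and "g = \<lceil>5 * real (lang_n ar) * real \<tau> * log 2 (real \<tau>)\<rceil>"
    and "0 < \<epsilon>" and "\<epsilon> \<le> 6 * real (max_arity ar) * real CARD('l)"
  shows "\<exists>\<delta>>0. \<forall>M. borel_structure ar M \<and> \<not> borel_branching ar \<delta> \<tau> M \<longrightarrow>
    (\<exists>Mp P. borel_structure ar Mp \<and> borel_partition P \<and> equitable P \<and>
       d1 ar M Mp \<le> \<epsilon> \<and>
       indivisible ar P Mp \<and>
       finite P \<and>
       real (card P) \<le> (\<epsilon> / (6 * real (max_arity ar) * real CARD('l))) powi (- ((g + 1) * (g + 2))))"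
proof -
  define q where "q = real (max_arity ar) * real CARD('l)"
  define \<eta> where "\<eta> = \<epsilon> / (6 * real (max_arity ar) * real CARD('l))"
  have q: "real CARD('l) \<le> q" "0 < q" using assms(1) by (auto simp: q_def mult_le_cancel_right1)
  have \<epsilon>: "\<epsilon> = 6 * real (max_arity ar) * real CARD('l) * \<eta>" using assms(1) by (simp add: \<eta>_def)
  have \<eta>: "0 < \<eta>" "\<eta> \<le> 1" using assms by (auto simp: \<eta>_def)
  have n: "1 \<le> lang_n ar" using assms(1) by (simp add: lang_n_def Suc_leI)
  let ?X = "\<eta> powi (- ((g + 1) * (g + 2)))"
  have "0 \<le> real \<tau> * log 2 (real \<tau>)" by (cases "\<tau> = 0") auto
  then have "0 \<le> 5 * real (lang_n ar) * real \<tau> * log 2 (real \<tau>)" by (simp add: mult.assoc)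
  then have "0 \<le> g" using assms(2) by linarith
  \<comment> \<open>Since \<open>\<eta> \<le> 1\<close> and the exponent of
    \<open>1 / \<eta>\<close> is nonnegative, one part is always within the bound; the two
    degenerate cases below rely on this.\<close>
  then have X1: "1 \<le> ?X"
    using \<eta> by (simp add: power_int_minus one_le_inverse_iff power_int_le_one)
  have m_exists: "\<exists>\<delta>>0. \<exists>m. real m \<le> ?X \<and> (\<forall>M. borel_structure ar M \<and> \<not> borel_branching ar \<delta> \<tau> M \<longrightarrow>
    (\<exists>Mp P. borel_structure ar Mp \<and> borel_partition P \<and> equitable P \<and>
       d1 ar M Mp \<le> \<epsilon> \<and> indivisible ar P Mp \<and> finite P \<and> card P = m))"
  proof -
    \<comment> \<open>For \<open>\<eta> > 1 / 6\<close> the tolerance \<open>\<epsilon>\<close>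
      exceeds the number of symbols and the empty structure will do. For
      \<open>\<tau> \<le> 1\<close> the estimate \<open>1 \<le> L\<close> behind
      \<open>parts_bound\<close> is lost, but a single centre suffices.\<close>
    consider (large) "1 / 6 < \<eta>" | (small_tree) "\<tau> \<le> 1" | (main) "\<eta> \<le> 1 / 6" "2 \<le> \<tau>" by linarith
    then show ?thesis
    proof cases
      case large
      have "real CARD('l) \<le> \<epsilon>"
      proof -
        have "q * (1 / 6) \<le> q * \<eta>" using large q by (intro mult_left_mono) auto
        moreover have "\<epsilon> = 6 * (q * \<eta>)" using \<epsilon> by (simp add: q_def)
        ultimately show ?thesis using q(1) by linarith
      qed
      then show ?thesis using trivial_approximation[of ar] X1
        by (intro exI[of _ 1] conjI exI[of _ 1] allI impI) (force intro: order.trans)+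
    next
      case small_tree
      \<comment> \<open>Sauer's exponent \<open>\<tau> - 1\<close> is 0, so two distinct traces
        already branch. With \<open>N = 2\<close> the failure bound reads
        \<open>4 * (1 - \<eta> / 2) ^ s \<le> 1 / 2\<close>, hence 1/8.\<close>
      obtain s where s: "(1 - \<eta> / 2) ^ s < 1 / 8"
        using real_arch_pow_inv[of "1 / 8" "1 - \<eta> / 2"] \<eta> by auto
      obtain \<delta> where "\<delta> > 0" "\<forall>M. borel_structure ar M \<and> \<not> borel_branching ar \<delta> \<tau> M \<longrightarrow>
        (\<exists>Mp P. borel_structure ar Mp \<and> borel_partition P \<and> equitable P \<and>
         d1 ar M Mp \<le> \<epsilon> \<and> indivisible ar P Mp \<and> finite P \<and> card P = 1)"
        using non_branching_approximation[where ar = ar and N = 2 and m = 1 and \<tau> = \<tau> and s = s, OF \<eta>, folded \<epsilon>]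
          s small_tree by auto
      then show ?thesis using X1 by (intro exI[of _ \<delta>] conjI exI[of _ 1]) auto
    next
      case main
      \<comment> \<open>\<open>sample_size_sufficient\<close> is used with
        \<open>a = \<eta> / 2\<close>, which doubles \<open>4 * \<tau> + 3\<close>.\<close>
      define S where "S = nat \<lceil>(8 * real \<tau> + 6) / \<eta>\<rceil>"
      have S_lb: "(8 * real \<tau> + 6) / \<eta> \<le> real S" unfolding S_def by (rule real_nat_ceiling_ge)
      have "8 * real \<tau> + 6 \<le> (8 * real \<tau> + 6) / \<eta>" using \<eta> by (simp add: le_divide_eq mult_left_le)
      then have S2: "2 \<le> S" using S_lb by linarith
      have S_ub: "real S \<le> (8 * real \<tau> + 7) / \<eta>"
      proof -
        have "real S \<le> (8 * real \<tau> + 6) / \<eta> + 1" unfolding S_def using \<eta> by (intro real_nat_ceiling_le) simp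
        also have "1 \<le> 1 / \<eta>" using \<eta> by simp
        finally show ?thesis by (simp add: add_divide_distrib)
      qed
      \<comment> \<open>Sauer's bound for \<open>s = S ^ 2 - 1\<close> blocks. It is also the number
        of centres allowed, since \<open>N = K + 1\<close>; \<open>m\<close> is then chosen so that
        the leftover \<open>K ^ lang_n ar / m\<close> is at most \<open>\<eta> / 2\<close>.\<close>
      define K where "K = (S ^ 2) ^ (\<tau> - 1)"
      define m where "m = nat \<lceil>2 * real (K ^ lang_n ar) / \<eta>\<rceil>"
      have K1: "1 \<le> K" using S2 by (simp add: K_def)
      have m_lb: "2 * real (K ^ lang_n ar) / \<eta> \<le> real m" unfolding m_def by (rule real_nat_ceiling_ge)
      have m_pos: "0 < m"
      proof -
        have "0 < 2 * real (K ^ lang_n ar) / \<eta>" using K1 \<eta> by simp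
        then have "0 < real m" using m_lb by linarith
        then show ?thesis by simp
      qed
      have m_ub: "real m \<le> 2 * real (K ^ lang_n ar) / \<eta> + 1"
        unfolding m_def using \<eta> by (intro real_nat_ceiling_le) simp
      have "real m \<le> ?X"
        using parts_bound[OF main(2) n \<eta>(1) main(1) assms(2) S_ub _ m_ub[unfolded K_def]] S2 by simp
      moreover have "(4 * real \<tau> + 3) / (\<eta> / 2) \<le> real S" using S_lb by (simp add: algebra_simps)
      then have s: "real (K + 1) ^ 2 * (1 - \<eta> / 2) ^ (S ^ 2 - 1) \<le> 1 / 2"
        unfolding K_def using \<eta> S2 by (intro sample_size_sufficient) auto
      have S1: "S ^ 2 - 1 + 1 = S ^ 2" using S2 by simp
      have "real (K ^ lang_n ar) / real m \<le> \<eta> / 2" using m_lb m_pos \<eta> by (simp add: field_simps)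
      then obtain \<delta> where "\<delta> > 0" "\<forall>M. borel_structure ar M \<and> \<not> borel_branching ar \<delta> \<tau> M \<longrightarrow>
        (\<exists>Mp P. borel_structure ar Mp \<and> borel_partition P \<and> equitable P \<and>
         d1 ar M Mp \<le> \<epsilon> \<and> indivisible ar P Mp \<and> finite P \<and> card P = m)"
        using non_branching_approximation[where ar = ar and N = "K + 1" and \<tau> = \<tau>, OF \<eta> m_pos s, folded \<epsilon>] K1
        unfolding S1 by (auto simp: K_def)
      ultimately show ?thesis by blast
    qed
  qed
  then obtain \<delta> m where "\<delta> > 0" and m: "real m \<le> ?X" and
    approx: "\<And>M. borel_structure ar M \<and> \<not> borel_branching ar \<delta> \<tau> M \<Longrightarrow>
      \<exists>Mp P. borel_structure ar Mp \<and> borel_partition P \<and> equitable P \<and>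
       d1 ar M Mp \<le> \<epsilon> \<and> indivisible ar P Mp \<and> finite P \<and> card P = m" by blast
  show ?thesis
    unfolding \<eta>_def[symmetric]
  proof (intro exI[of _ \<delta>] conjI allI impI \<open>\<delta> > 0\<close>)
    fix M assume "borel_structure ar M \<and> \<not> borel_branching ar \<delta> \<tau> M"
    from approx[OF this] show "\<exists>Mp P. borel_structure ar Mp \<and> borel_partition P \<and> equitable P \<and>
       d1 ar M Mp \<le> \<epsilon> \<and> indivisible ar P Mp \<and> finite P \<and> real (card P) \<le> ?X"
      using m by blast
  qed
qed

end
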